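(* Let $T$ be an ergodic measure-preserving transformation on a non-atomic Lebesgue space $(X,\mu)$ with $\mu(X)=1$. If $T$ is measurably sensitive, then there is some positive integer $n$ such that $T^n$ has $n$ invariant sets of positive measure which cover almost all of $X$, and the restriction of $T^n$ to each of these sets is lightly mixing.
   Context: A measurable set $A$ is invariant under $S$ if $S^{-1}(A)=A$ modulo $\mu$. A transformation $S$ of a finite measure space $(Y,\nu)$ is lightly mixing if $\liminf_{n\to\infty}\nu(S^{-n}(A)\cap B)>0$ for all sets $A,B\subset Y$ of positive measure. A metric $d$ on a measure space is good if all nonempty open sets have positive measure; when a space carries a good metric, the measure on it is assumed to be regular (so open sets are measurable). $B_\varepsilon(x)$ denotes the open $d$-ball of radius $\varepsilon$ about $x$. Two systems $(X,\mu,T)$ and $(X_1,\mu_1,T_1)$ are measure-theoretically isomorphic if, after discarding null sets (with forward-invariant complements), there is a bimeasurable bijection between them that carries $\mu$ to $\mu_1$ and intertwines $T$ and $T_1$. $T$ is measurably sensitive if whenever $(X_1,\mu_1,T_1)$ is measure-theoretically isomorphic to $(X,\mu,T)$ and $d$ is a good metric on $X_1$, there exists $\delta>0$ such that for all $x\in X_1$ and all $\varepsilon>0$ there exists $N\in\mathbb{N}$ such that for all integers $n\ge N$, $\mu_1\{y\in B_\varepsilon(x): d(T_1^n(x),T_1^n(y))>\delta\}>0$. *)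

theory Defs
  imports "HOL-Probability.Probability"
begin

section \<open>Isomorphisms modulo null sets and Lebesgue spaces\<close>

definition isomorphism_mod_null ::
    "'a measure \<Rightarrow> 'b measure \<Rightarrow> 'a set \<Rightarrow> 'b set \<Rightarrow> ('a \<Rightarrow> 'b) \<Rightarrow> bool" where
  "isomorphism_mod_null M M1 N N1 \<phi> \<longleftrightarrow>
     (let X = space M - N; X1 = space M1 - N1 in
        N \<in> null_sets M \<and> N1 \<in> null_sets M1 \<and>
        bij_betw \<phi> X X1 \<and>
        \<phi> \<in> measurable (restrict_space M X) (restrict_space M1 X1) \<and>
        the_inv_into X \<phi> \<in> measurable (restrict_space M1 X1) (restrict_space M X) \<and>
        distr (restrict_space M X) (restrict_space M1 X1) \<phi> = restrict_space M1 X1)"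

text \<open>A Lebesgue space is a complete measure space isomorphic, modulo null sets, to an interval
  with Lebesgue measure together with countably many point masses. Here \<open>C\<close> is the set of
  point masses; the interval may be empty or degenerate.\<close>

definition lebesgue_space :: "'a measure \<Rightarrow> bool" where
  "lebesgue_space M \<longleftrightarrow>
     complete_measure M \<and>
     (\<exists>C. countable C \<and> C \<subseteq> space M \<and> (\<forall>x\<in>C. {x} \<in> sets M \<and> emeasure M {x} < \<infinity>) \<and>
        (\<exists>(I :: real set) N N1 \<phi>. is_interval I \<and>
           isomorphism_mod_null (restrict_space M (space M - C)) (lebesgue_on I) N N1 \<phi>))"

definition non_atomic :: "'a measure \<Rightarrow> bool" where
  "non_atomic M \<longleftrightarrow>
     \<not> (\<exists>A\<in>sets M. 0 < emeasure M A \<and>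
          (\<forall>B\<in>sets M. B \<subseteq> A \<longrightarrow> emeasure M B = 0 \<or> emeasure M (A - B) = 0))"


section \<open>Transformations\<close>

definition measure_preserving :: "'a measure \<Rightarrow> ('a \<Rightarrow> 'a) \<Rightarrow> bool" where
  "measure_preserving M T \<longleftrightarrow> T \<in> measurable M M \<and> distr M M T = M"

definition invariant_set :: "'a measure \<Rightarrow> ('a \<Rightarrow> 'a) \<Rightarrow> 'a set \<Rightarrow> bool" where
  "invariant_set M S A \<longleftrightarrow> A \<in> sets M \<and> sym_diff (S -` A \<inter> space M) A \<in> null_sets M"

definition ergodic :: "'a measure \<Rightarrow> ('a \<Rightarrow> 'a) \<Rightarrow> bool" where
  "ergodic M T \<longleftrightarrow>
     (\<forall>A. invariant_set M T A \<longrightarrow> emeasure M A = 0 \<or> emeasure M (space M - A) = 0)"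

text \<open>If \<open>A\<close> is invariant under \<open>S\<close>, then only a null set of points of \<open>A\<close> ever leaves \<open>A\<close> under
  iteration of \<open>S\<close>. Hence \<open>lightly_mixing (restrict_space M A) S\<close> expresses that the restriction
  of \<open>S\<close> to \<open>A\<close> is lightly mixing, without changing \<open>S\<close> or \<open>A\<close> on a null set.\<close>

definition lightly_mixing :: "'a measure \<Rightarrow> ('a \<Rightarrow> 'a) \<Rightarrow> bool" where
  "lightly_mixing M S \<longleftrightarrow>
     (\<forall>A\<in>sets M. \<forall>B\<in>sets M. 0 < emeasure M A \<longrightarrow> 0 < emeasure M B \<longrightarrow>
        0 < liminf (\<lambda>n. emeasure M ((S ^^ n) -` A \<inter> B)))"

definition isomorphic_systems ::
    "'a measure \<Rightarrow> ('a \<Rightarrow> 'a) \<Rightarrow> 'b measure \<Rightarrow> ('b \<Rightarrow> 'b) \<Rightarrow> bool" where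
  "isomorphic_systems M T M1 T1 \<longleftrightarrow>
     (\<exists>N N1 \<phi>. isomorphism_mod_null M M1 N N1 \<phi> \<and>
        T ` (space M - N) \<subseteq> space M - N \<and>
        T1 ` (space M1 - N1) \<subseteq> space M1 - N1 \<and>
        (\<forall>x\<in>space M - N. \<phi> (T x) = T1 (\<phi> x)))"


section \<open>Good metrics and measurable sensitivity\<close>

text \<open>Regularity is meant as usual for finite measures on metric spaces: measurable sets are
  approximated by closed sets from inside and by open sets from outside.\<close>

definition regular_measure :: "'a measure \<Rightarrow> ('a \<Rightarrow> 'a \<Rightarrow> real) \<Rightarrow> bool" where
  "regular_measure M d \<longleftrightarrow>
     (\<forall>U. openin (Metric_space.mtopology (space M) d) U \<longrightarrow> U \<in> sets M) \<and>
     (\<forall>A\<in>sets M. \<forall>\<epsilon>>0. \<exists>F U.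
        closedin (Metric_space.mtopology (space M) d) F \<and>
        openin (Metric_space.mtopology (space M) d) U \<and>
        F \<subseteq> A \<and> A \<subseteq> U \<and> emeasure M (U - F) < \<epsilon>)"

definition good_metric :: "'a measure \<Rightarrow> ('a \<Rightarrow> 'a \<Rightarrow> real) \<Rightarrow> bool" where
  "good_metric M d \<longleftrightarrow>
     Metric_space (space M) d \<and> regular_measure M d \<and>
     (\<forall>U. openin (Metric_space.mtopology (space M) d) U \<longrightarrow> U \<noteq> {} \<longrightarrow> 0 < emeasure M U)"

text \<open>The isomorphic systems range over all systems whose points have the same type as those of
  the given one. For \<open>M\<close> a non-atomic Lebesgue probability space this is no restriction: a
  good metric on a probability space is separable, because disjoint balls have positive measure,
  so the space has at most the cardinality of the continuum, whereas \<open>M\<close> has at least that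
  cardinality. Every relevant system thus has an isometric copy on a subset of \<open>'a\<close>.\<close>

definition measurably_sensitive :: "'a measure \<Rightarrow> ('a \<Rightarrow> 'a) \<Rightarrow> bool" where
  "measurably_sensitive M T \<longleftrightarrow>
     (\<forall>(M1 :: 'a measure) T1 d.
        T1 \<in> measurable M1 M1 \<longrightarrow> isomorphic_systems M T M1 T1 \<longrightarrow> good_metric M1 d \<longrightarrow>
        (\<exists>\<delta>>0. \<forall>x\<in>space M1. \<forall>\<epsilon>>0. \<exists>N::nat. \<forall>n\<ge>N.
           0 < emeasure M1 {y \<in> Metric_space.mball (space M1) d x \<epsilon>.
                              \<delta> < d ((T1 ^^ n) x) ((T1 ^^ n) y)}))"

end

theory Submission
  imports Defs
begin

text \<open>If \<open>T\<close> is measurably sensitive, then there is \<open>\<epsilon> > 0\<close> such that \<open>\<mu>(C) \<ge> \<epsilon>\<close> whenever some \<open>B\<close> of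
  positive measure satisfies \<open>T\<^sup>n(B) \<subseteq> C\<close> modulo \<open>\<mu>\<close> for infinitely many \<open>n\<close>: otherwise there is
  a good metric that shrinks such sets \<open>C\<close> of rapidly decreasing measure to small diameter while the
  corresponding \<open>B\<close> contain balls.

  This bound alone gives the theorem. It applies to sets \<open>B = C\<close> that are invariant under a power
  of \<open>T\<close>, so some such set is not divisible further; its preimages under \<open>T\<close> form the required
  cycle, and all powers of \<open>T\<^sup>n\<close> are ergodic on each of its members. If all powers of \<open>S\<close> are
  ergodic and \<open>S\<close> is not lightly mixing, then along some sequence of times images of sets \<open>B\<close> of
  positive measure asymptotically avoid sets \<open>A\<close>. The sets \<open>A\<close> have measure at most \<open>\<mu>(X) - \<epsilon>\<close>,
  and an increasing sequence of them with almost maximal measure converges to a set that is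
  invariant under a power of \<open>S\<close> and is neither null nor conull, a contradiction.\<close>

section \<open>Preimages under a measure-preserving transformation\<close>

locale finite_mpt = finite_measure M for M :: "'a measure" +
  fixes T :: "'a \<Rightarrow> 'a"
  assumes preserving: "measure_preserving M T"
begin

definition pre :: "nat \<Rightarrow> 'a set \<Rightarrow> 'a set" where
  "pre n A = (T ^^ n) -` A \<inter> space M"

lemma measurable_funpow: "T ^^ n \<in> measurable M M"
proof (induction n)
  case 0
  show ?case by (simp add: id_def)
next
  case (Suc n)
  then show ?case using preserving unfolding measure_preserving_def
    by (auto intro: measurable_comp)
qed

lemma space_funpow: "x \<in> space M \<Longrightarrow> (T ^^ n) x \<in> space M"
  using measurable_space[OF measurable_funpow] .

lemma pre_sets [measurable, simp, intro]: "A \<in> sets M \<Longrightarrow> pre n A \<in> sets M"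
  unfolding pre_def by (rule measurable_sets[OF measurable_funpow])

lemma pre_0: "A \<in> sets M \<Longrightarrow> pre 0 A = A"
  using sets.sets_into_space by (auto simp: pre_def)

lemma pre_pre: "pre m (pre n A) = pre (n + m) A"
  by (auto simp: pre_def funpow_add space_funpow)

lemma emeasure_pre: "A \<in> sets M \<Longrightarrow> emeasure M (pre n A) = emeasure M A"
proof (induction n)
  case 0
  then show ?case by (simp add: pre_0)
next
  case (Suc n)
  have "emeasure M (pre 1 (pre n A)) = emeasure (distr M M T) (pre n A)"
    using preserving Suc.prems
    by (subst emeasure_distr) (auto simp: pre_def measure_preserving_def)
  then show ?case using preserving Suc by (simp add: pre_pre measure_preserving_def)
qed

lemma measure_pre: "A \<in> sets M \<Longrightarrow> measure M (pre n A) = measure M A"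
  by (simp add: emeasure_pre measure_def)

lemma pre_null: "A \<in> null_sets M \<Longrightarrow> pre n A \<in> null_sets M"
  by (auto simp: null_sets_def emeasure_pre)

lemma pre_Un: "pre n (A \<union> B) = pre n A \<union> pre n B"
  and pre_Int: "pre n (A \<inter> B) = pre n A \<inter> pre n B"
  and pre_Diff: "pre n (A - B) = pre n A - pre n B"
  and pre_UN: "pre n (\<Union>i\<in>I. F i) = (\<Union>i\<in>I. pre n (F i))"
  by (auto simp: pre_def)

lemma pre_mono: "A \<subseteq> B \<Longrightarrow> pre n A \<subseteq> pre n B"
  by (auto simp: pre_def)

text \<open>A set and its preimage have the same finite measure, so an inclusion between them can be
  strict only by a null set.\<close>

lemma pre_subset_null:
  assumes "A \<in> sets M" "pre n A \<subseteq> A"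
  shows "A - pre n A \<in> null_sets M"
proof -
  have "emeasure M (A - pre n A) = emeasure M A - emeasure M (pre n A)"
    using assms by (intro emeasure_Diff) auto
  then show ?thesis using assms by (auto simp: emeasure_pre)
qed

section \<open>The pseudometric of symmetric differences\<close>

definition rho :: "'a set \<Rightarrow> 'a set \<Rightarrow> real" where
  "rho A B = measure M (sym_diff A B)"

lemma rho_commute: "rho A B = rho B A"
  by (simp add: rho_def Un_commute)

lemma rho_triangle:
  assumes "A \<in> sets M" "B \<in> sets M" "C \<in> sets M"
  shows "rho A C \<le> rho A B + rho B C"
proof -
  have "rho A C \<le> measure M (sym_diff A B \<union> sym_diff B C)"
    unfolding rho_def using assms by (intro finite_measure_mono) auto
  also have "\<dots> \<le> rho A B + rho B C"
    unfolding rho_def using assms by (intro measure_Un_le) auto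
  finally show ?thesis .
qed

lemma rho_pre:
  assumes "A \<in> sets M" "B \<in> sets M"
  shows "rho (pre n A) (pre n B) = rho A B"
proof -
  have "sym_diff (pre n A) (pre n B) = pre n (sym_diff A B)"
    by (simp add: pre_Un pre_Diff)
  then show ?thesis unfolding rho_def using assms by (simp add: measure_pre)
qed

lemma rho_eq_0_iff:
  assumes "A \<in> sets M" "B \<in> sets M"
  shows "rho A B = 0 \<longleftrightarrow> sym_diff A B \<in> null_sets M"
  using assms by (auto simp: rho_def null_sets_def emeasure_eq_measure)

section \<open>Recurrence, and covering by preimages\<close>

text \<open>Pigeonhole: the \<open>Suc K\<close> preimages of \<open>D\<close> at the times
  \<open>0, N, ..., K * N\<close> have equal measure, too large in total for them to be pairwise
  disjoint modulo null sets. A large \<open>N\<close> yields late return times, \<open>N = 1\<close>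
  a return time bounded by \<open>K\<close>.\<close>

lemma return_time:
  assumes D: "D \<in> sets M" and K: "measure M (space M) < real (Suc K) * measure M D"
  shows "\<exists>i. 0 < i \<and> i \<le> K \<and> 0 < measure M (D \<inter> pre (i * N) D)"
proof (rule ccontr)
  assume "\<not> ?thesis"
  then have null: "measure M (D \<inter> pre (i * N) D) = 0" if "0 < i" "i \<le> K" for i
    using that measure_nonneg[of M] by (meson antisym_conv2 not_less)
  have null': "measure M (pre (j * N) D \<inter> pre (l * N) D) = 0" if "j < l" "l \<le> K" for j l
  proof -
    have "pre (j * N) D \<inter> pre (l * N) D = pre (j * N) (D \<inter> pre ((l - j) * N) D)"
      using that by (simp add: pre_Int pre_pre left_diff_distrib')
    then show ?thesis using null[of "l - j"] that D by (simp add: measure_pre)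
  qed
  have "measure M (\<Union>j<k. pre (j * N) D) = real k * measure M D" if "k \<le> Suc K" for k
    using that
  proof (induction k)
    case (Suc k)
    have U: "(\<Union>j<k. pre (j * N) D) \<in> sets M" using D by auto
    have "measure M ((\<Union>j<k. pre (j * N) D) \<inter> pre (k * N) D)
      \<le> (\<Sum>j<k. measure M (pre (j * N) D \<inter> pre (k * N) D))"
      unfolding Int_UN_distrib2 UN_extend_simps
      using D by (intro order_trans[OF _ finite_measure_subadditive_finite]) auto
    also have "\<dots> = 0" using null' Suc.prems by (intro sum.neutral) auto
    finally have 0: "measure M (pre (k * N) D \<inter> (\<Union>j<k. pre (j * N) D)) = 0"
      using measure_nonneg[of M] by (metis Int_commute antisym)
    have "measure M (\<Union>j<Suc k. pre (j * N) D)
        = measure M (pre (k * N) D \<union> (\<Union>j<k. pre (j * N) D))"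
      by (simp add: lessThan_Suc)
    also have "\<dots> = measure M (pre (k * N) D) + measure M (\<Union>j<k. pre (j * N) D)
        - measure M (pre (k * N) D \<inter> (\<Union>j<k. pre (j * N) D))"
      using D U by (intro measure_Un3) (auto simp: fmeasurable_def less_top[symmetric])
    finally show ?case using Suc 0 D by (simp add: measure_pre algebra_simps)
  qed simp
  from this[of "Suc K"] have "real (Suc K) * measure M D \<le> measure M (space M)"
    by (metis bounded_measure order_refl)
  with K show False by simp
qed

lemma infinite_returns:
  assumes B: "B \<in> sets M" "0 < measure M B"
  shows "\<exists>\<^sub>\<infinity>i. 0 < measure M (B \<inter> pre i B)"
  unfolding INFM_nat_le
proof
  fix N
  obtain K where "measure M (space M) < real K * measure M B"
    using reals_Archimedean3[OF B(2)] by blast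
  then have "measure M (space M) < real (Suc K) * measure M B"
    using B(2) by (simp add: algebra_simps)
  from return_time[OF B(1) this, of N] obtain i where
    "0 < i" "0 < measure M (B \<inter> pre (i * N) B)" by blast
  then show "\<exists>n\<ge>N. 0 < measure M (B \<inter> pre n B)"
    by (intro exI[of _ "i * N"]) auto
qed

text \<open>The union of all preimages contains its own preimage, so it is invariant modulo a null
  set; it contains \<open>B\<close> and hence is not null.\<close>

lemma ergodic_cover:
  assumes erg: "ergodic M T" and B: "B \<in> sets M" "0 < measure M B"
  shows "space M - (\<Union>j. pre j B) \<in> null_sets M"
proof -
  let ?W = "\<Union>j. pre j B"
  have W: "?W \<in> sets M" using B by auto
  have sub: "pre 1 ?W \<subseteq> ?W" by (auto simp: pre_UN pre_pre)
  have "sym_diff (T -` ?W \<inter> space M) ?W \<in> null_sets M"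
    using pre_subset_null[OF W sub] sub by (simp add: pre_def Diff_eq_empty_iff[THEN iffD2])
  then have "invariant_set M T ?W" using W by (simp add: invariant_set_def)
  then have "emeasure M ?W = 0 \<or> emeasure M (space M - ?W) = 0"
    using erg by (simp add: ergodic_def)
  moreover have "measure M B \<le> measure M ?W"
    using W pre_0[OF B(1)] by (intro finite_measure_mono) auto
  then have "emeasure M ?W \<noteq> 0" using B by (auto simp: emeasure_eq_measure)
  ultimately show ?thesis using W by (auto simp: null_sets_def)
qed

lemma ergodic_meet:
  assumes erg: "ergodic M T" and B: "B \<in> sets M" "0 < measure M B"
    and D: "D \<in> sets M" "0 < measure M D"
  shows "\<exists>j. 0 < measure M (D \<inter> pre j B)"
proof (rule ccontr)
  assume "\<not> ?thesis"
  then have "D \<inter> pre j B \<in> null_sets M" for j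
    using B D by (auto simp: null_sets_def emeasure_eq_measure not_less measure_le_0_iff)
  then have "(\<Union>j. D \<inter> pre j B) \<union> (space M - (\<Union>j. pre j B)) \<in> null_sets M"
    by (intro null_sets.Un null_sets_UN ergodic_cover[OF erg B])
  moreover have "D \<subseteq> (\<Union>j. D \<inter> pre j B) \<union> (space M - (\<Union>j. pre j B))"
    using sets.sets_into_space[OF D(1)] by auto
  ultimately have "D \<in> null_sets M" using D null_sets_subset by blast
  then show False using D by (auto simp: null_sets_def emeasure_eq_measure)
qed

end

section \<open>Light mixing of totally ergodic transformations\<close>

context finite_mpt
begin

text \<open>Asymptotically no point of \<open>B\<close> is sent into \<open>A\<close> at the times
  \<open>r k\<close>. One sequence \<open>r\<close> is shared by all pairs, which allows pairs to be
  combined.\<close>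

definition avoids :: "(nat \<Rightarrow> nat) \<Rightarrow> 'a set \<Rightarrow> 'a set \<Rightarrow> bool" where
  "avoids r A B \<longleftrightarrow> A \<in> sets M \<and> B \<in> sets M \<and> (\<lambda>k. measure M (pre (r k) A \<inter> B)) \<longlonglongrightarrow> 0"

lemma avoids_Un_Int:
  assumes "avoids r A B" "avoids r A' B'"
  shows "avoids r (A \<union> A') (B \<inter> B')"
proof -
  have sets: "A \<in> sets M" "B \<in> sets M" "A' \<in> sets M" "B' \<in> sets M"
    using assms by (auto simp: avoids_def)
  have sum_tendsto: "(\<lambda>k. measure M (pre (r k) A \<inter> B) + measure M (pre (r k) A' \<inter> B')) \<longlonglongrightarrow> 0"
    using assms by (intro tendsto_add_zero) (auto simp: avoids_def)
  have "measure M (pre (r k) (A \<union> A') \<inter> (B \<inter> B'))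
      \<le> measure M (pre (r k) A \<inter> B) + measure M (pre (r k) A' \<inter> B')" for k
  proof -
    have "measure M (pre (r k) (A \<union> A') \<inter> (B \<inter> B'))
        \<le> measure M ((pre (r k) A \<inter> B) \<union> (pre (r k) A' \<inter> B'))"
      using sets by (intro finite_measure_mono) (auto simp: pre_Un)
    also have "\<dots> \<le> measure M (pre (r k) A \<inter> B) + measure M (pre (r k) A' \<inter> B')"
      using sets by (intro measure_Un_le) auto
    finally show ?thesis .
  qed
  then have "(\<lambda>k. measure M (pre (r k) (A \<union> A') \<inter> (B \<inter> B'))) \<longlonglongrightarrow> 0"
    by (intro real_tendsto_sandwich[OF _ _ tendsto_const sum_tendsto]) simp_all
  then show ?thesis using sets by (auto simp: avoids_def)
qed

lemma avoids_pre:
  assumes "avoids r A B"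
  shows "avoids r (pre j A) (pre j B)"
proof -
  have sets: "A \<in> sets M" "B \<in> sets M" using assms by (auto simp: avoids_def)
  have "pre (r k) (pre j A) \<inter> pre j B = pre j (pre (r k) A \<inter> B)" for k
    by (simp add: pre_Int pre_pre add.commute)
  then show ?thesis using assms sets by (auto simp: avoids_def measure_pre)
qed

text \<open>Along a thinned sequence of times the parts of \<open>B\<close> that are sent into
  \<open>A\<close> have total measure at most half of that of \<open>B\<close>. The remaining points
  of \<open>B\<close> are sent into the complement of \<open>A\<close> at all these times, so
  \<open>small\<close> bounds that complement from below.\<close>

lemma avoids_measure_le:
  assumes small: "\<And>B C. B \<in> sets M \<Longrightarrow> C \<in> sets M \<Longrightarrow> 0 < measure M B \<Longrightarrow>
      \<exists>\<^sub>\<infinity>n. B - pre n C \<in> null_sets M \<Longrightarrow> \<epsilon> \<le> measure M C"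
    and r: "\<And>k. k \<le> r k" and av: "avoids r A B" and B: "0 < measure M B"
  shows "measure M A \<le> measure M (space M) - \<epsilon>"
proof -
  let ?b = "measure M B"
  have sets: "A \<in> sets M" "B \<in> sets M" using av by (auto simp: avoids_def)
  have "\<exists>k\<ge>i. measure M (pre (r k) A \<inter> B) < ?b / 2 * (1/2) ^ Suc i" for i
  proof -
    have "0 < ?b / 2 * (1/2) ^ Suc i" using B by simp
    moreover have "(\<lambda>k. measure M (pre (r k) A \<inter> B)) \<longlonglongrightarrow> 0" using av by (simp add: avoids_def)
    ultimately have "eventually (\<lambda>k. measure M (pre (r k) A \<inter> B) < ?b / 2 * (1/2) ^ Suc i) sequentially"
      by (rule order_tendstoD(2)[rotated])
    then obtain N where "\<And>k. N \<le> k \<Longrightarrow> measure M (pre (r k) A \<inter> B) < ?b / 2 * (1/2) ^ Suc i"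
      unfolding eventually_sequentially by blast
    then show ?thesis by (intro exI[of _ "max i N"]) simp
  qed
  then obtain s where s: "\<And>i. i \<le> s i"
    "\<And>i. measure M (pre (r (s i)) A \<inter> B) < ?b / 2 * (1/2) ^ Suc i"
    by metis
  let ?E = "\<lambda>i. pre (r (s i)) A \<inter> B"
  have sums: "(\<lambda>i. ?b / 2 * (1/2) ^ Suc i) sums (?b / 2 * 1)"
    by (intro sums_mult power_half_series)
  have summ: "summable (\<lambda>i. measure M (?E i))"
    using s(2) by (intro summable_comparison_test'[OF sums_summable[OF sums]]) (simp add: less_imp_le)
  have "measure M (\<Union>i. ?E i) \<le> (\<Sum>i. measure M (?E i))"
    using sets summ by (intro finite_measure_subadditive_countably) auto
  also have "\<dots> \<le> (\<Sum>i. ?b / 2 * (1/2) ^ Suc i)"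
    using s(2) by (intro suminf_le summ sums_summable[OF sums]) (simp add: less_imp_le)
  also have "\<dots> = ?b / 2" using sums_unique[OF sums] by simp
  finally have le: "measure M (\<Union>i. ?E i) \<le> ?b / 2" .
  let ?B = "B - (\<Union>i. ?E i)"
  have "measure M ?B = ?b - measure M (\<Union>i. ?E i)"
    using sets by (intro finite_measure_Diff) auto
  with le B have pos: "0 < measure M ?B" by simp
  have empty: "?B - pre (r (s i)) (space M - A) = {}" for i
    using sets.sets_into_space[OF sets(2)] by (fastforce simp: pre_def space_funpow)
  have "\<exists>\<^sub>\<infinity>n. ?B - pre n (space M - A) \<in> null_sets M"
    unfolding INFM_nat_le
  proof
    fix m
    \<comment> \<open>The bounds \<open>i \<le> s i\<close> and \<open>k \<le> r k\<close> make the
      selected times arbitrarily large.\<close>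
    show "\<exists>n\<ge>m. ?B - pre n (space M - A) \<in> null_sets M"
      using order_trans[OF s(1)[of m] r] by (intro exI[of _ "r (s m)"]) (simp only: empty null_sets.empty_sets simp_thms)
  qed
  then have "\<epsilon> \<le> measure M (space M - A)"
    using sets pos by (intro small[of ?B]) auto
  then show ?thesis using sets by (simp add: finite_measure_compl)
qed

text \<open>If \<open>A\<close> avoids \<open>B\<close> and \<open>A\<close> has almost maximal measure, then \<open>T\<^sup>-\<^sup>jA\<close> and \<open>T\<^sup>-\<^sup>lA\<close> almost coincide
  whenever \<open>T\<^sup>-\<^sup>jB\<close> and \<open>T\<^sup>-\<^sup>lB\<close> meet, because their union avoids \<open>T\<^sup>-\<^sup>jB \<inter> T\<^sup>-\<^sup>lB\<close>. Hence every return
  time of \<open>B\<close> maps \<open>B\<close> into the union \<open>D\<close> of those translates of \<open>B\<close> that belong to a translate of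
  \<open>A\<close> close to \<open>A\<close>. So \<open>D\<close> is not small, and a return time of \<open>D\<close> is an almost period of \<open>A\<close>.\<close>

lemma almost_period:
  assumes erg: "ergodic M T"
    and small: "\<And>B C. B \<in> sets M \<Longrightarrow> C \<in> sets M \<Longrightarrow> 0 < measure M B \<Longrightarrow>
      \<exists>\<^sub>\<infinity>n. B - pre n C \<in> null_sets M \<Longrightarrow> \<epsilon> \<le> measure M C"
    and K: "measure M (space M) < real (Suc K) * \<epsilon>"
    and max: "\<And>A B. avoids r A B \<Longrightarrow> 0 < measure M B \<Longrightarrow> measure M A \<le> a"
    and AB: "avoids r A B" "0 < measure M B" "a - h \<le> measure M A"
  shows "\<exists>i. 0 < i \<and> i \<le> K \<and> rho A (pre i A) \<le> 10 * h"
proof -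
  have sets [simp]: "A \<in> sets M" "B \<in> sets M" using AB by (auto simp: avoids_def)
  have close: "rho (pre j A) (pre l A) \<le> 2 * h" if "0 < measure M (pre j B \<inter> pre l B)" for j l
  proof -
    have "measure M (pre j A \<union> pre l A) \<le> a"
      using that AB(1) by (intro max[OF avoids_Un_Int]) (auto intro: avoids_pre)
    moreover have "measure M (pre j A \<union> pre l A) = measure M (pre j A) + measure M (pre l A - pre j A)"
      by (intro finite_measure_Union') auto
    moreover have "measure M (pre j A \<union> pre l A) = measure M (pre l A) + measure M (pre j A - pre l A)"
      by (subst Un_commute, intro finite_measure_Union') auto
    moreover have "rho (pre j A) (pre l A)
        = measure M (pre j A - pre l A) + measure M (pre l A - pre j A)"
      unfolding rho_def by (intro finite_measure_Union sets.Diff pre_sets sets) auto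
    ultimately show ?thesis using AB(3) by (simp add: measure_pre)
  qed
  \<comment> \<open>The tolerance \<open>4 * h\<close> is two applications of \<open>close\<close>,
    joined by the triangle inequality through \<open>pre 0 A\<close> in
    \<open>return_D\<close>.\<close>
  define J where "J = {j. rho (pre j A) A \<le> 4 * h}"
  define D where "D = (\<Union>j\<in>J. pre j B)"
  have D [simp]: "D \<in> sets M" unfolding D_def by (intro sets.countable_UN' pre_sets sets) auto
  have return_D: "B - pre i D \<in> null_sets M" if i: "0 < measure M (B \<inter> pre i B)" for i
  proof -
    have "B \<inter> pre i (pre j B) \<in> null_sets M" if "j \<notin> J" for j
    proof (rule ccontr)
      assume "B \<inter> pre i (pre j B) \<notin> null_sets M"
      moreover have "B \<inter> pre i (pre j B) \<in> sets M" by (intro sets.Int pre_sets sets)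
      ultimately have "0 < measure M (B \<inter> pre i (pre j B))"
        by (auto simp: null_sets_def emeasure_eq_measure zero_less_measure_iff)
      then have "rho (pre (j + i) A) (pre 0 A) \<le> 2 * h"
        by (intro close) (simp add: pre_0 pre_pre Int_commute)
      moreover have "rho (pre 0 A) (pre i A) \<le> 2 * h"
        using i by (intro close) (simp add: pre_0)
      moreover have "rho (pre j A) A = rho (pre (j + i) A) (pre i A)"
        using rho_pre[of "pre j A" A i] by (simp add: pre_pre)
      ultimately have "rho (pre j A) A \<le> 4 * h"
        using rho_triangle[of "pre (j + i) A" "pre 0 A" "pre i A"] by simp
      then show False using that by (simp add: J_def)
    qed
    \<comment> \<open>A point of \<open>B\<close> outside \<open>pre i D\<close> is sent by
      \<open>T ^^ i\<close> either into a translate of \<open>B\<close> with index outside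
      \<open>J\<close> or outside all translates; by ergodicity the second case is null as
      well.\<close>
    then have "(\<Union>j\<in>-J. B \<inter> pre i (pre j B)) \<union> pre i (space M - (\<Union>j. pre j B)) \<in> null_sets M"
      by (intro null_sets.Un null_sets_UN' pre_null ergodic_cover[OF erg sets(2) AB(2)]) auto
    moreover have "B - pre i D \<subseteq> (\<Union>j\<in>-J. B \<inter> pre i (pre j B)) \<union> pre i (space M - (\<Union>j. pre j B))"
    proof
      fix x assume x: "x \<in> B - pre i D"
      then have "x \<in> space M" using sets.sets_into_space[OF sets(2)] by blast
      with x show "x \<in> (\<Union>j\<in>-J. B \<inter> pre i (pre j B)) \<union> pre i (space M - (\<Union>j. pre j B))"
        unfolding D_def by (auto simp: pre_def space_funpow)
    qed
    ultimately show ?thesis by (elim null_sets_subset) auto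
  qed
  from infinite_returns[OF sets(2) AB(2)] have "\<exists>\<^sub>\<infinity>i. B - pre i D \<in> null_sets M"
    by (rule INFM_mono) (rule return_D)
  then have "\<epsilon> \<le> measure M D" using AB(2) by (intro small) auto
  then have "measure M (space M) < real (Suc K) * measure M D"
    using K by (elim less_le_trans) (rule mult_left_mono, simp_all)
  \<comment> \<open>The lower bound on \<open>D\<close> depends only on \<epsilon>, so the bound
    \<open>K\<close> on the period depends neither on \<open>A\<close> nor on
    \<open>h\<close>.\<close>
  from return_time[OF D this, of 1] obtain i where
    i: "0 < i" "i \<le> K" "0 < measure M (D \<inter> pre i D)" by auto
  have D_return: "D \<inter> pre i D = (\<Union>j\<in>J. \<Union>l\<in>J. pre j B \<inter> pre (l + i) B)"
    unfolding D_def by (auto simp: pre_UN pre_pre)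
  have "\<exists>j\<in>J. \<exists>l\<in>J. 0 < measure M (pre j B \<inter> pre (l + i) B)"
  proof (rule ccontr)
    assume "\<not> ?thesis"
    then have "(\<Union>j\<in>J. \<Union>l\<in>J. pre j B \<inter> pre (l + i) B) \<in> null_sets M"
      by (intro null_sets_UN') (auto simp: null_sets_def emeasure_eq_measure zero_less_measure_iff)
    then have "measure M (D \<inter> pre i D) = 0"
      unfolding D_return by (rule measure_eq_0_null_sets)
    with i(3) show False by simp
  qed
  then obtain j l where jl: "j \<in> J" "l \<in> J" "0 < measure M (pre j B \<inter> pre (l + i) B)"
    by blast
  \<comment> \<open>The three terms contribute \<open>4 * h\<close>, \<open>2 * h\<close> and
    \<open>4 * h\<close>, whence the constant 10.\<close>
  have "rho A (pre i A) \<le> rho A (pre j A) + rho (pre j A) (pre (l + i) A) + rho (pre (l + i) A) (pre i A)"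
    using rho_triangle[of A "pre j A" "pre i A"] rho_triangle[of "pre j A" "pre (l + i) A" "pre i A"]
    by simp
  moreover have "rho (pre (l + i) A) (pre i A) = rho (pre l A) A"
    using rho_pre[of "pre l A" A i] by (simp add: pre_pre)
  ultimately have "rho A (pre i A) \<le> 10 * h"
    using close[OF jl(3)] jl(1,2) by (simp add: J_def rho_commute)
  then show ?thesis using i by blast
qed

text \<open>All almost periods supplied by \<open>almost_period\<close> lie in one finite set
  \<open>{1..K}\<close>, so a single one serves infinitely many sets of the increasing sequence and
  becomes an exact period, modulo null sets, of their union. The supremum of the measures is
  positive and at most \<open>measure M (space M) - \<epsilon>\<close>, so this union contradicts
  ergodicity of a power.\<close>

theorem lightly_mixing_if_totally_ergodic:
  assumes erg: "\<And>i. 0 < i \<Longrightarrow> ergodic M (T ^^ i)"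
    and \<epsilon>: "0 < \<epsilon>"
    and small: "\<And>B C. B \<in> sets M \<Longrightarrow> C \<in> sets M \<Longrightarrow> 0 < measure M B \<Longrightarrow>
      \<exists>\<^sub>\<infinity>n. B - pre n C \<in> null_sets M \<Longrightarrow> \<epsilon> \<le> measure M C"
  shows "lightly_mixing M T"
proof (rule ccontr)
  assume "\<not> lightly_mixing M T"
  then obtain A0 B0 where AB0: "A0 \<in> sets M" "B0 \<in> sets M" "0 < emeasure M A0" "0 < emeasure M B0"
    "\<not> 0 < liminf (\<lambda>n. emeasure M ((T ^^ n) -` A0 \<inter> B0))"
    unfolding lightly_mixing_def by blast
  have pre_Int': "(T ^^ n) -` A0 \<inter> B0 = pre n A0 \<inter> B0" for n
    using sets.sets_into_space[OF AB0(2)] by (auto simp: pre_def)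
  \<comment> \<open>If this failed for some \<open>k\<close>, then
    \<open>inverse (real (Suc k))\<close> would bound the lower limit from below.\<close>
  have "\<exists>n\<ge>k. measure M (pre n A0 \<inter> B0) < inverse (real (Suc k))" for k
  proof (rule ccontr)
    assume "\<not> ?thesis"
    then have "inverse (real (Suc k)) \<le> measure M (pre n A0 \<inter> B0)" if "k \<le> n" for n
      using that not_less by blast
    then have "eventually (\<lambda>n. ennreal (inverse (real (Suc k))) \<le> emeasure M ((T ^^ n) -` A0 \<inter> B0)) sequentially"
      unfolding pre_Int' emeasure_eq_measure by (intro eventually_sequentiallyI[of k] ennreal_leI)
    from Liminf_bounded[OF this] have "0 < liminf (\<lambda>n. emeasure M ((T ^^ n) -` A0 \<inter> B0))"
      by (rule less_le_trans[rotated]) simp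
    with AB0(5) show False ..
  qed
  then obtain r where r: "\<And>k. k \<le> r k" "\<And>k. measure M (pre (r k) A0 \<inter> B0) < inverse (real (Suc k))"
    by metis
  have "(\<lambda>k. measure M (pre (r k) A0 \<inter> B0)) \<longlonglongrightarrow> 0"
    using r(2) by (intro real_tendsto_sandwich[OF _ _ tendsto_const LIMSEQ_inverse_real_of_nat])
      (simp_all add: less_imp_le del: of_nat_Suc)
  then have av0: "avoids r A0 B0" using AB0 by (simp add: avoids_def)
  have pos0: "0 < measure M A0" "0 < measure M B0"
    using AB0 by (auto simp: emeasure_eq_measure)
  have bound: "measure M A \<le> measure M (space M) - \<epsilon>" if "avoids r A B" "0 < measure M B" for A B
    using avoids_measure_le[OF small r(1) that] .
  define S where "S = {measure M A |A. \<exists>B. avoids r A B \<and> 0 < measure M B}"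
  define a where "a = Sup S"
  have bdd: "bdd_above S" unfolding S_def bdd_above_def using bound by blast
  have ne: "S \<noteq> {}" using av0 pos0 by (auto simp: S_def)
  have max: "measure M A \<le> a" if "avoids r A B" "0 < measure M B" for A B
    unfolding a_def using that by (intro cSup_upper[OF _ bdd]) (auto simp: S_def)
  have near: "\<exists>A B. avoids r A B \<and> 0 < measure M B \<and> a - h \<le> measure M A" if "0 < h" for h
  proof -
    have "a - h < Sup S" using that by (simp add: a_def)
    then obtain y where "y \<in> S" "a - h < y" using less_cSup_iff[OF ne bdd] by blast
    then show ?thesis by (auto simp: S_def intro: less_imp_le)
  qed
  have erg1: "ergodic M T" using erg[of 1] by simp
  define P where "P k p \<longleftrightarrow> avoids r (fst p) (snd p) \<and> 0 < measure M (snd p) \<and> a - (1/2) ^ k \<le> measure M (fst p)"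
    for k and p :: "'a set \<times> 'a set"
  have "\<exists>f. \<forall>k. P k (f k) \<and> fst (f k) \<subseteq> fst (f (Suc k))"
  proof (rule dependent_nat_choice)
    from near[of 1] obtain A B where "avoids r A B" "0 < measure M B" "a - 1 \<le> measure M A" by auto
    then have "P 0 (A, B)" by (simp add: P_def)
    then show "\<exists>p. P 0 p" ..
  next
    fix p k assume p: "P k p"
    obtain A B where AB: "avoids r A B" "0 < measure M B" "a - (1/2) ^ Suc k \<le> measure M A"
      using near[of "(1/2) ^ Suc k"] by auto
    have sets: "A \<in> sets M" "B \<in> sets M" "fst p \<in> sets M" "snd p \<in> sets M"
      using AB p by (auto simp: avoids_def P_def)
    \<comment> \<open>The near-optimal pair \<open>(A, B)\<close> may be unrelated to
      \<open>p\<close>. By ergodicity a translate of \<open>B\<close> meets \<open>snd p\<close> in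
      positive measure, and translating does not change the measure of \<open>A\<close>.\<close>
    obtain j where j: "0 < measure M (snd p \<inter> pre j B)"
      using ergodic_meet[OF erg1 sets(2) AB(2) sets(4)] p by (auto simp: P_def)
    have "measure M A \<le> measure M (fst p \<union> pre j A)"
      using sets by (subst measure_pre[of A j, symmetric]) (auto intro!: finite_measure_mono)
    then have "P (Suc k) (fst p \<union> pre j A, snd p \<inter> pre j B)"
      using p AB j unfolding P_def fst_conv snd_conv
      by (intro conjI avoids_Un_Int avoids_pre order_trans[OF AB(3)]) auto
    moreover have "fst p \<subseteq> fst (fst p \<union> pre j A, snd p \<inter> pre j B)" by simp
    ultimately show "\<exists>q. P (Suc k) q \<and> fst p \<subseteq> fst q" by blast
  qed
  then obtain f where f: "\<And>k. P k (f k)" "\<And>k. fst (f k) \<subseteq> fst (f (Suc k))" by blast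
  define A where "A k = fst (f k)" for k
  have A [simp]: "A k \<in> sets M" for k using f(1)[of k] by (simp add: P_def A_def avoids_def)
  have A_le: "measure M (A k) \<le> a" and A_ge: "a - (1/2) ^ k \<le> measure M (A k)" for k
    using f(1)[of k] max by (auto simp: P_def A_def)
  define L where "L = (\<Union>k. A k)"
  have L [simp]: "L \<in> sets M" unfolding L_def by auto
  have "(\<lambda>k. measure M (A k)) \<longlonglongrightarrow> measure M L"
    unfolding L_def
  proof (rule finite_Lim_measure_incseq)
    show "range A \<subseteq> sets M" using A by blast
    show "incseq A" using f(2) by (simp add: A_def incseq_Suc_iff)
  qed
  then have L_le: "measure M L \<le> a" using A_le by (intro LIMSEQ_le_const2) auto
  have rho_L: "rho L (A k) \<le> (1/2) ^ k" for k
  proof -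
    have "rho L (A k) = measure M (L - A k)"
      unfolding rho_def by (intro arg_cong[where f = "measure M"]) (auto simp: L_def)
    also have "\<dots> = measure M L - measure M (A k)"
      by (intro finite_measure_Diff) (auto simp: L_def)
    finally show ?thesis using L_le A_ge[of k] by simp
  qed
  obtain K where "measure M (space M) < real K * \<epsilon>"
    using reals_Archimedean3[OF \<epsilon>] by blast
  then have K: "measure M (space M) < real (Suc K) * \<epsilon>" using \<epsilon> by (simp add: algebra_simps)
  have "\<exists>i\<in>{1..K}. rho (A k) (pre i (A k)) \<le> 10 * (1/2) ^ k" for k
  proof -
    have near_k: "avoids r (A k) (snd (f k))" "0 < measure M (snd (f k))" "a - (1/2) ^ k \<le> measure M (A k)"
      using f(1)[of k] unfolding P_def A_def by blast+
    have "\<exists>i. 0 < i \<and> i \<le> K \<and> rho (A k) (pre i (A k)) \<le> 10 * (1/2) ^ k"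
      by (rule almost_period[OF erg1 _ K _ near_k]) (rule small, assumption+, rule max, assumption+)
    then obtain i where "0 < i" "i \<le> K" "rho (A k) (pre i (A k)) \<le> 10 * (1/2) ^ k"
      by blast
    then show ?thesis by (intro bexI[of _ i]) simp_all
  qed
  \<comment> \<open>Pigeonhole over the finite set \<open>{1..K}\<close> makes \<open>i\<close>
    independent of \<open>k\<close> for infinitely many \<open>k\<close>.\<close>
  then have "\<exists>\<^sub>\<infinity>k. \<exists>i\<in>{1..K}. rho (A k) (pre i (A k)) \<le> 10 * (1/2) ^ k"
    unfolding INFM_nat_le by blast
  then obtain i where i: "i \<in> {1..K}" "\<exists>\<^sub>\<infinity>k. rho (A k) (pre i (A k)) \<le> 10 * (1/2) ^ k"
    by (subst (asm) frequently_bex_finite_distrib) auto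
  have "rho L (pre i L) \<le> 0"
  proof (rule field_le_epsilon)
    fix e :: real assume "0 < e"
    \<comment> \<open>The triangle inequality below adds 1, 10 and 1 times \<open>(1/2) ^ k\<close>,
      hence the 12.\<close>
    then obtain N where N: "(1/2) ^ N < e / 12" using real_arch_pow_inv[of "e / 12" "1/2"] by auto
    obtain k where k: "k \<ge> N" "rho (A k) (pre i (A k)) \<le> 10 * (1/2) ^ k"
      using i(2) unfolding INFM_nat_le by blast
    have "(1/2 :: real) ^ k \<le> (1/2) ^ N" using k(1) by (intro power_decreasing) auto
    moreover have "rho (pre i (A k)) (pre i L) \<le> (1/2) ^ k"
      using rho_L[of k] rho_commute by (simp add: rho_pre)
    moreover have "rho L (pre i L) \<le> rho L (A k) + rho (A k) (pre i (A k)) + rho (pre i (A k)) (pre i L)"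
      using rho_triangle[of L "A k" "pre i L"] rho_triangle[of "A k" "pre i (A k)" "pre i L"]
      by simp
    ultimately show "rho L (pre i L) \<le> 0 + e" using k(2) rho_L[of k] N by linarith
  qed
  then have "rho L (pre i L) = 0" unfolding rho_def using measure_nonneg by (intro antisym) auto
  then have "sym_diff ((T ^^ i) -` L \<inter> space M) L \<in> null_sets M"
    by (simp add: rho_eq_0_iff pre_def[symmetric] Un_commute)
  then have "invariant_set M (T ^^ i) L" by (simp add: invariant_set_def)
  then have "emeasure M L = 0 \<or> emeasure M (space M - L) = 0"
    using erg[of i] i(1) by (auto simp: ergodic_def)
  moreover have "0 < measure M L"
  proof -
    have "0 < a" using max[OF av0 pos0(2)] pos0 by simp
    moreover have "(\<lambda>k. a - (1/2) ^ k) \<longlonglongrightarrow> a - 0" by (intro tendsto_intros LIMSEQ_power_zero) simp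
    then have "a - 0 \<le> measure M L"
    proof (rule LIMSEQ_le_const2)
      have "measure M (A k) \<le> measure M L" for k
        by (intro finite_measure_mono) (auto simp: L_def)
      then show "\<exists>N. \<forall>k\<ge>N. a - (1/2) ^ k \<le> measure M L"
        using order_trans[OF A_ge] by blast
    qed
    ultimately show ?thesis by simp
  qed
  moreover have "a \<le> measure M (space M) - \<epsilon>"
    unfolding a_def using ne by (rule cSup_least) (use bound in \<open>auto simp: S_def\<close>)
  then have "0 < measure M (space M - L)"
    using L_le \<epsilon> by (simp add: finite_measure_compl)
  ultimately show False by (auto simp: emeasure_eq_measure)
qed

end

section \<open>Periodic sets\<close>

context finite_mpt
begin

lemma invariant_set_iff:
  "invariant_set M (T ^^ q) Z \<longleftrightarrow> Z \<in> sets M \<and> rho (pre q Z) Z = 0"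
  unfolding invariant_set_def pre_def[symmetric] by (auto simp: rho_eq_0_iff)

lemma invariant_set_pre:
  assumes "invariant_set M (T ^^ q) Z"
  shows "invariant_set M (T ^^ q) (pre j Z)"
  using assms rho_pre[of "pre q Z" Z j] by (auto simp: invariant_set_iff pre_pre add.commute)

lemma invariant_set_mult:
  assumes "invariant_set M (T ^^ q) Z"
  shows "invariant_set M (T ^^ (q * k)) Z"
proof (induction k)
  case 0
  show ?case using assms
    by (subst mult_0_right, subst invariant_set_iff) (simp add: invariant_set_iff pre_0 rho_def)
next
  case (Suc k)
  have Z: "Z \<in> sets M" using assms by (simp add: invariant_set_iff)
  have "rho (pre (q * Suc k) Z) Z \<le> rho (pre q (pre (q * k) Z)) (pre q Z) + rho (pre q Z) Z"
    using rho_triangle[of "pre (q * Suc k) Z" "pre q Z" Z] Z by (simp add: pre_pre add.commute)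
  also have "\<dots> = 0" using Suc assms Z by (simp add: rho_pre invariant_set_iff)
  finally show ?case using Z by (auto simp: invariant_set_iff rho_def measure_le_0_iff)
qed

lemma invariant_set_Int_Diff:
  assumes "invariant_set M (T ^^ q) Z" "invariant_set M (T ^^ q) W"
  shows "invariant_set M (T ^^ q) (Z \<inter> W)" "invariant_set M (T ^^ q) (Z - W)"
proof -
  have sets: "Z \<in> sets M" "W \<in> sets M" using assms by (auto simp: invariant_set_iff)
  have null: "sym_diff (pre q Z) Z \<union> sym_diff (pre q W) W \<in> null_sets M"
    using assms sets by (auto simp: invariant_set_iff rho_eq_0_iff)
  have "sym_diff (pre q (Z \<inter> W)) (Z \<inter> W) \<in> null_sets M"
    by (rule null_sets_subset[OF null]) (use sets in \<open>auto simp: pre_Int\<close>)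
  then show "invariant_set M (T ^^ q) (Z \<inter> W)"
    using sets by (simp add: invariant_set_iff rho_eq_0_iff)
  have "sym_diff (pre q (Z - W)) (Z - W) \<in> null_sets M"
    by (rule null_sets_subset[OF null]) (use sets in \<open>auto simp: pre_Diff\<close>)
  then show "invariant_set M (T ^^ q) (Z - W)"
    using sets by (simp add: invariant_set_iff rho_eq_0_iff)
qed

text \<open>The period is left open, since splitting a set further may require a larger one.\<close>

definition periodic :: "'a set \<Rightarrow> bool" where
  "periodic Z \<longleftrightarrow> (\<exists>q>0. invariant_set M (T ^^ q) Z)"

lemma periodic_sets: "periodic Z \<Longrightarrow> Z \<in> sets M"
  by (auto simp: periodic_def invariant_set_def)

lemma periodic_pre: "periodic Z \<Longrightarrow> periodic (pre j Z)"
  by (auto simp: periodic_def intro: invariant_set_pre)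

text \<open>The product of two periods is a common period, and the sets invariant under one fixed
  power are closed under intersection and difference.\<close>

lemma periodic_Int_Diff:
  assumes "periodic Z" "periodic W"
  shows "periodic (Z \<inter> W)" "periodic (Z - W)"
proof -
  obtain q p where "q > 0" "invariant_set M (T ^^ q) Z" "p > 0" "invariant_set M (T ^^ p) W"
    using assms by (auto simp: periodic_def)
  then have "q * p > 0" "invariant_set M (T ^^ (q * p)) Z" "invariant_set M (T ^^ (q * p)) W"
    using invariant_set_mult[of q Z p] invariant_set_mult[of p W q] by (simp_all add: mult.commute)
  then show "periodic (Z \<inter> W)" "periodic (Z - W)"
    unfolding periodic_def using invariant_set_Int_Diff by blast+
qed

text \<open>The periodic sets of positive measure have measure at least \<open>\<epsilon>\<close>; one of measure less than
  twice their infimum cannot be split into two of them.\<close>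

lemma ex_periodic_atom:
  assumes pos: "0 < measure M (space M)" and \<epsilon>: "0 < \<epsilon>"
    and small: "\<And>B C. B \<in> sets M \<Longrightarrow> C \<in> sets M \<Longrightarrow> 0 < measure M B \<Longrightarrow>
      \<exists>\<^sub>\<infinity>n. B - pre n C \<in> null_sets M \<Longrightarrow> \<epsilon> \<le> measure M C"
  shows "\<exists>Z. periodic Z \<and> 0 < measure M Z \<and>
    (\<forall>j W. periodic W \<longrightarrow> 0 < measure M (pre j Z \<inter> W) \<longrightarrow> measure M (pre j Z - W) = 0)"
proof -
  define S where "S = {measure M Z |Z. periodic Z \<and> 0 < measure M Z}"
  \<comment> \<open>The hypothesis \<open>small\<close> is applied with both sets equal to
    \<open>Z\<close>, at the multiples of a period.\<close>
  have lower: "\<epsilon> \<le> measure M Z" if Z: "periodic Z" "0 < measure M Z" for Z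
  proof (rule small[OF periodic_sets periodic_sets])
    obtain q where q: "q > 0" "invariant_set M (T ^^ q) Z" using Z(1) by (auto simp: periodic_def)
    have null: "Z - pre (q * k) Z \<in> null_sets M" for k
    proof (rule null_sets_subset)
      show "sym_diff (pre (q * k) Z) Z \<in> null_sets M"
        using invariant_set_mult[OF q(2), of k] periodic_sets[OF Z(1)]
        by (simp add: invariant_set_iff rho_eq_0_iff)
    qed (use periodic_sets[OF Z(1)] in auto)
    show "\<exists>\<^sub>\<infinity>n. Z - pre n Z \<in> null_sets M"
      unfolding INFM_nat_le
    proof
      fix k
      show "\<exists>n\<ge>k. Z - pre n Z \<in> null_sets M"
        using q(1) by (intro exI[of _ "q * k"] conjI null) simp
    qed
  qed (use Z in auto)
  have "invariant_set M (T ^^ 1) (space M)"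
  proof -
    have "pre 1 (space M) = space M" using space_funpow unfolding pre_def by blast
    then show ?thesis by (subst invariant_set_iff) (simp add: rho_def)
  qed
  then have "measure M (space M) \<in> S" using pos unfolding S_def periodic_def by force
  then have ne: "S \<noteq> {}" by auto
  have bdd: "bdd_below S" unfolding S_def bdd_below_def using lower by blast
  have "\<epsilon> \<le> Inf S" using ne by (rule cInf_greatest) (use lower in \<open>auto simp: S_def\<close>)
  then have "Inf S < 2 * Inf S" using \<epsilon> by simp
  then obtain y where "y \<in> S" "y < 2 * Inf S" using cInf_less_iff[OF ne bdd] by blast
  then obtain Z where Z: "periodic Z" "0 < measure M Z" "measure M Z < 2 * Inf S"
    by (auto simp: S_def)
  have Inf_le: "Inf S \<le> measure M W" if "periodic W" "0 < measure M W" for W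
    using that by (intro cInf_lower[OF _ bdd]) (auto simp: S_def)
  \<comment> \<open>Only the measure of \<open>Z\<close> and its periodicity enter, and all its
    preimages share them; thus every member of the later cycle is covered.\<close>
  have "measure M (pre j Z - W) = 0" if W: "periodic W" "0 < measure M (pre j Z \<inter> W)" for j W
  proof (rule ccontr)
    assume "measure M (pre j Z - W) \<noteq> 0"
    then have "0 < measure M (pre j Z - W)" by (simp add: zero_less_measure_iff)
    with W have "Inf S \<le> measure M (pre j Z - W)" "Inf S \<le> measure M (pre j Z \<inter> W)"
      using Z(1) by (auto intro!: Inf_le periodic_Int_Diff periodic_pre)
    moreover have "measure M Z = measure M (pre j Z - W) + measure M (pre j Z \<inter> W)"
      using periodic_sets[OF Z(1)] periodic_sets[OF W(1)]
      by (subst finite_measure_Union[symmetric]) (auto simp: Un_Diff_Int measure_pre)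
    ultimately show False using Z(3) by simp
  qed
  with Z show ?thesis by blast
qed

text \<open>An invariant set agrees almost everywhere with the set of points that visit it infinitely
  often, which equals its preimage exactly.\<close>

lemma ex_strictly_invariant:
  assumes Z: "invariant_set M (T ^^ n) Z"
  obtains Z' where "Z' \<in> sets M" "rho Z Z' = 0" "pre n Z' = Z'"
proof
  let ?Z = "{x \<in> space M. \<exists>\<^sub>\<infinity>k. (T ^^ (n * k)) x \<in> Z}"
  have sets: "Z \<in> sets M" using Z by (simp add: invariant_set_def)
  have eq: "?Z = (\<Inter>N. \<Union>k\<in>{N..}. pre (n * k) Z)"
    unfolding INFM_nat_le pre_def by (auto simp: Bex_def)
  show Z': "?Z \<in> sets M"
    unfolding eq using sets by (intro sets.countable_INT' sets.countable_UN' pre_sets) auto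
  have "sym_diff (pre (n * k) Z) Z \<in> null_sets M" for k
    using invariant_set_mult[OF Z, of k] sets by (simp add: invariant_set_iff rho_eq_0_iff)
  then have null: "(\<Union>k. sym_diff (pre (n * k) Z) Z) \<in> null_sets M" by blast
  have "sym_diff Z ?Z \<subseteq> (\<Union>k. sym_diff (pre (n * k) Z) Z)"
    unfolding eq by fastforce
  then have "sym_diff Z ?Z \<in> null_sets M"
    using sets Z' by (intro null_sets_subset[OF null]) auto
  then show "rho Z ?Z = 0" using sets Z' by (simp add: rho_eq_0_iff)
  have "(\<exists>\<^sub>\<infinity>k. (T ^^ (n * k)) ((T ^^ n) x) \<in> Z) \<longleftrightarrow> (\<exists>\<^sub>\<infinity>k. (T ^^ (n * k)) x \<in> Z)" for x
  proof -
    have "(T ^^ (n * k)) ((T ^^ n) x) = (T ^^ (n * Suc k)) x" for k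
      using funpow_add[of "n * k" n T] by (simp add: add.commute)
    then show ?thesis
      unfolding frequently_def cofinite_eq_sequentially
      by (simp only: eventually_sequentially_Suc[of "\<lambda>k. (T ^^ (n * k)) x \<notin> Z"])
  qed
  then show "pre n ?Z = ?Z" by (auto simp: pre_def space_funpow)
qed

section \<open>Restriction to the members of the cycle\<close>

text \<open>The exact equality \<open>pre n A = A\<close>, rather than one modulo null sets, makes
  \<open>T ^^ n\<close> a self-map of the restricted space.\<close>

lemma finite_mpt_restrict:
  assumes A: "A \<in> sets M" "pre n A = A"
  shows "finite_mpt (restrict_space M A) (T ^^ n)"
proof -
  have sub: "A \<subseteq> space M" using A sets.sets_into_space by blast
  interpret R: finite_measure "restrict_space M A"
    using A by (intro finite_measure_restrict_space finite_measure_axioms) auto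
  have meas: "T ^^ n \<in> measurable (restrict_space M A) (restrict_space M A)"
  proof (rule measurable_restrict_space3)
    show "T ^^ n \<in> measurable M M" by (rule measurable_funpow)
    show "T ^^ n \<in> A \<rightarrow> A" using A(2) unfolding pre_def by blast
  qed
  show ?thesis
  proof
    show "measure_preserving (restrict_space M A) (T ^^ n)"
      unfolding measure_preserving_def
    proof (intro conjI meas measure_eqI)
      fix Y assume "Y \<in> sets (distr (restrict_space M A) (restrict_space M A) (T ^^ n))"
      then have Y': "Y \<in> sets (restrict_space M A)" by simp
      then have Y: "Y \<in> sets M" "Y \<subseteq> A" using A by (auto simp: sets_restrict_space_iff sub Int_absorb2)
      have eq: "(T ^^ n) -` Y \<inter> space (restrict_space M A) = pre n Y"
        using A(2) Y(2) pre_mono[OF Y(2), of n] sub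
        by (auto simp: pre_def space_restrict_space)
      have "emeasure (distr (restrict_space M A) (restrict_space M A) (T ^^ n)) Y
          = emeasure (restrict_space M A) (pre n Y)"
        using emeasure_distr[OF meas Y'] by (simp only: eq)
      also have "\<dots> = emeasure M (pre n Y)"
        using A pre_mono[OF Y(2), of n] sub by (intro emeasure_restrict_space) auto
      also have "\<dots> = emeasure (restrict_space M A) Y"
        using A Y sub by (subst emeasure_restrict_space) (auto simp: emeasure_pre)
      finally show "emeasure (distr (restrict_space M A) (restrict_space M A) (T ^^ n)) Y
          = emeasure (restrict_space M A) Y" .
    qed simp
  qed
qed

text \<open>A subset of \<open>A\<close> that is invariant under the \<open>k\<close>-th power of
  \<open>T ^^ n\<close> is periodic for \<open>T\<close> with period \<open>n * k\<close>, so
  \<open>atom\<close> makes all powers of the restriction ergodic. The bound \<open>small\<close> is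
  inherited because infinitely many \<open>k\<close> give infinitely many times
  \<open>n * k\<close>.\<close>

lemma lightly_mixing_restrict:
  assumes A: "A \<in> sets M" "pre n A = A" and n: "0 < n"
    and atom: "\<And>W. periodic W \<Longrightarrow> 0 < measure M (A \<inter> W) \<Longrightarrow> measure M (A - W) = 0"
    and \<epsilon>: "0 < \<epsilon>"
    and small: "\<And>B C. B \<in> sets M \<Longrightarrow> C \<in> sets M \<Longrightarrow> 0 < measure M B \<Longrightarrow>
      \<exists>\<^sub>\<infinity>n. B - pre n C \<in> null_sets M \<Longrightarrow> \<epsilon> \<le> measure M C"
  shows "lightly_mixing (restrict_space M A) (T ^^ n)"
proof -
  have sub: "A \<subseteq> space M" using A sets.sets_into_space by blast
  interpret R: finite_mpt "restrict_space M A" "T ^^ n"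
    using A by (rule finite_mpt_restrict)
  have sets_R: "Y \<in> sets (restrict_space M A) \<longleftrightarrow> Y \<in> sets M \<and> Y \<subseteq> A" for Y
    using A sub by (auto simp: sets_restrict_space_iff Int_absorb2)
  have null_R: "Y \<in> null_sets (restrict_space M A) \<longleftrightarrow> Y \<subseteq> A \<and> Y \<in> null_sets M" for Y
    using A(1) by (rule null_sets_restrict_space)
  have space_R: "space (restrict_space M A) = A" using sub by (auto simp: space_restrict_space)
  have measure_R: "measure (restrict_space M A) Y = measure M Y" if "Y \<subseteq> A" for Y
    using that A sub by (intro measure_restrict_space) auto
  have pre_A: "pre (n * k) A = A" for k
  proof (induction k)
    case (Suc k)
    then have "pre n (pre (n * k) A) = A" using A by simp
    then show ?case by (simp add: pre_pre add.commute)
  qed (simp add: pre_0 A)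
  have pre_R: "R.pre k Y = pre (n * k) Y" if "Y \<subseteq> A" for k Y
    using pre_mono[OF that, of "n * k"] sub
    unfolding R.pre_def pre_A space_R by (auto simp: pre_def funpow_mult)
  show ?thesis
  proof (rule R.lightly_mixing_if_totally_ergodic[OF _ \<epsilon>])
    fix k :: nat assume k: "0 < k"
    show "ergodic (restrict_space M A) ((T ^^ n) ^^ k)"
      unfolding ergodic_def
    proof (intro allI impI)
      fix W assume "invariant_set (restrict_space M A) ((T ^^ n) ^^ k) W"
      then have W: "W \<in> sets M" "W \<subseteq> A" "sym_diff (pre (n * k) W) W \<in> null_sets M"
        unfolding invariant_set_def R.pre_def[symmetric] by (auto simp: sets_R null_R pre_R)
      then have "periodic W"
        unfolding periodic_def invariant_set_def pre_def[symmetric] using n k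
        by (intro exI[of _ "n * k"]) simp
      from atom[OF this] have "measure M W = 0 \<or> measure M (A - W) = 0"
        using W(2) by (auto simp: Int_absorb1 zero_less_measure_iff)
      then show "emeasure (restrict_space M A) W = 0 \<or>
          emeasure (restrict_space M A) (space (restrict_space M A) - W) = 0"
        using W(2) by (auto simp: R.emeasure_eq_measure measure_R space_R)
    qed
  next
    fix B C assume BC: "B \<in> sets (restrict_space M A)" "C \<in> sets (restrict_space M A)"
      "0 < measure (restrict_space M A) B" "\<exists>\<^sub>\<infinity>k. B - R.pre k C \<in> null_sets (restrict_space M A)"
    have "\<exists>\<^sub>\<infinity>k. B - pre k C \<in> null_sets M"
      unfolding INFM_nat_le
    proof
      fix N
      obtain k where k: "k \<ge> N" "B - R.pre k C \<in> null_sets (restrict_space M A)"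
        using BC(4) unfolding INFM_nat_le by blast
      have "B - pre (n * k) C \<in> null_sets M" using k(2) BC(2) by (simp add: null_R pre_R sets_R)
      moreover have "N \<le> n * k" using k(1) n by (cases n) auto
      ultimately show "\<exists>k\<ge>N. B - pre k C \<in> null_sets M" by blast
    qed
    then have "\<epsilon> \<le> measure M C" using BC by (intro small[of B]) (auto simp: sets_R measure_R)
    then show "\<epsilon> \<le> measure (restrict_space M A) C" using BC(2) by (simp add: sets_R measure_R)
  qed
qed

text \<open>Let \<open>n\<close> be the first positive time at which an indivisible periodic set
  \<open>Y\<close> overlaps its preimage. Indivisibility turns the overlap into equality modulo null
  sets, minimality of \<open>n\<close> makes the preimages at earlier times disjoint from
  \<open>Y\<close>, and ergodicity makes the cycle cover the space.\<close>

theorem lightly_mixing_decomposition: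
  assumes erg: "ergodic M T" and pos: "0 < measure M (space M)" and \<epsilon>: "0 < \<epsilon>"
    and small: "\<And>B C. B \<in> sets M \<Longrightarrow> C \<in> sets M \<Longrightarrow> 0 < measure M B \<Longrightarrow>
      \<exists>\<^sub>\<infinity>n. B - pre n C \<in> null_sets M \<Longrightarrow> \<epsilon> \<le> measure M C"
  shows "\<exists>n>0. \<exists>A :: nat \<Rightarrow> 'a set.
           (\<forall>i<n. invariant_set M (T ^^ n) (A i) \<and> 0 < emeasure M (A i)) \<and>
           (\<forall>i<n. \<forall>j<n. i \<noteq> j \<longrightarrow> A i \<inter> A j \<in> null_sets M) \<and>
           space M - (\<Union>i<n. A i) \<in> null_sets M \<and>
           (\<forall>i<n. lightly_mixing (restrict_space M (A i)) (T ^^ n))"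
proof -
  have "\<exists>Y. periodic Y \<and> 0 < measure M Y \<and>
      (\<forall>j W. periodic W \<longrightarrow> 0 < measure M (pre j Y \<inter> W) \<longrightarrow> measure M (pre j Y - W) = 0)"
    by (rule ex_periodic_atom[OF pos \<epsilon>]) (rule small, assumption+)
  then obtain Y where Y: "periodic Y" "0 < measure M Y"
    "\<And>j W. periodic W \<Longrightarrow> 0 < measure M (pre j Y \<inter> W) \<Longrightarrow> measure M (pre j Y - W) = 0"
    by blast
  note Y_sets = periodic_sets[OF Y(1)]
  define n where "n = (LEAST n. 0 < n \<and> 0 < measure M (Y \<inter> pre n Y))"
  have "\<exists>n. 0 < n \<and> 0 < measure M (Y \<inter> pre n Y)"
    using infinite_returns[OF Y_sets Y(2)] unfolding INFM_nat by blast
  from LeastI_ex[OF this] have n: "0 < n" "0 < measure M (Y \<inter> pre n Y)"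
    unfolding n_def by auto
  have least: "measure M (Y \<inter> pre k Y) = 0" if "0 < k" "k < n" for k
    using not_less_Least[OF that(2)[unfolded n_def]] that(1) by (simp add: zero_less_measure_iff)
  have "measure M (Y - pre n Y) = 0"
    \<comment> \<open>Indivisibility of \<open>Y\<close> itself gives this inclusion, that of its
      \<open>n\<close>-th preimage the converse one below.\<close>
    using Y(3)[of "pre n Y" 0] n(2) periodic_pre[OF Y(1)] by (simp add: pre_0 Y_sets)
  moreover have "measure M (pre n Y - Y) = 0"
    using Y(3)[of Y n] n(2) Y(1) by (simp add: Int_commute)
  moreover have "rho (pre n Y) Y = measure M (pre n Y - Y) + measure M (Y - pre n Y)"
    unfolding rho_def using Y_sets by (intro finite_measure_Union) auto
  ultimately have "invariant_set M (T ^^ n) Y" using Y_sets by (simp add: invariant_set_iff)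
  from ex_strictly_invariant[OF this] obtain Z where Z [simp]: "Z \<in> sets M"
    and YZ: "rho Y Z = 0" and pre_n: "pre n Z = Z" by blast
  have null: "sym_diff (pre j Y) (pre j Z) \<in> null_sets M" for j
    using rho_pre[of Y Z j] Y_sets YZ by (simp add: rho_eq_0_iff)
  define A where "A i = pre i Z" for i
  have A_sets [simp]: "A i \<in> sets M" for i by (simp add: A_def)
  \<comment> \<open>Disjointness and indivisibility are known for \<open>Y\<close>; these equations
    carry them over to the strictly invariant versions \<open>A j\<close>.\<close>
  have cong1: "measure M (pre j Y \<inter> W) = measure M (A j \<inter> W)"
    and cong2: "measure M (pre j Y - W) = measure M (A j - W)" if "W \<in> sets M" for j W
  proof -
    have ae: "AE x in M. x \<in> pre j Y \<longleftrightarrow> x \<in> A j"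
      using AE_not_in[OF null[of j]] by eventually_elim (auto simp: A_def)
    show "measure M (pre j Y \<inter> W) = measure M (A j \<inter> W)"
      using ae that Y_sets by (intro finite_measure_eq_AE) auto
    show "measure M (pre j Y - W) = measure M (A j - W)"
      using ae that Y_sets by (intro finite_measure_eq_AE) auto
  qed
  have pre_nA: "pre n (A i) = A i" for i
  proof -
    have "pre n (A i) = pre i (pre n Z)" by (simp add: A_def pre_pre add.commute)
    then show ?thesis by (simp add: pre_n A_def)
  qed
  have A_mod: "A i = A (i mod n)" for i
  proof (induction i rule: less_induct)
    case (less i)
    show ?case
    proof (cases "i < n")
      case False
      then have "A i = pre n (A (i - n))" by (simp add: A_def pre_pre)
      also have "\<dots> = A (i mod n)" using less[of "i - n"] False n(1) by (simp add: pre_nA le_mod_geq)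
      finally show ?thesis .
    qed simp
  qed
  have measure_A: "measure M (A i) = measure M Y" for i
    using cong1[of "space M" i] Y_sets
    by (metis A_sets Int_absorb2 measure_pre pre_sets sets.sets_into_space sets.top)
  have disj: "A i \<inter> A j \<in> null_sets M" if "i < j" "j < n" for i j
  proof -
    have "measure M (A 0 \<inter> A (j - i)) = measure M (pre (j - i) Y \<inter> A 0)"
      using cong1[OF A_sets, of "j - i" 0] by (simp add: Int_commute)
    also have "\<dots> = measure M (pre 0 Y \<inter> pre (j - i) Y)"
      using cong1[OF pre_sets[OF Y_sets], of 0 "j - i"] by (simp add: Int_commute)
    finally have "measure M (A 0 \<inter> A (j - i)) = 0" using least[of "j - i"] that by (simp add: pre_0 Y_sets)
    moreover have "A i \<inter> A j = pre i (A 0 \<inter> A (j - i))"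
      using that by (simp add: A_def pre_Int pre_pre)
    ultimately have "measure M (A i \<inter> A j) = 0" using measure_pre[OF sets.Int[OF A_sets A_sets], of i 0 "j - i"] by simp
    then show ?thesis by (auto simp: null_sets_def emeasure_eq_measure)
  qed
  show ?thesis
  proof (intro exI[of _ n] exI[of _ A] conjI allI impI n(1))
    fix i
    show "invariant_set M (T ^^ n) (A i)" by (simp add: invariant_set_iff pre_nA rho_def)
    show "0 < emeasure M (A i)" using Y(2) by (simp add: emeasure_eq_measure measure_A)
    show "lightly_mixing (restrict_space M (A i)) (T ^^ n)"
    proof (rule lightly_mixing_restrict[OF A_sets pre_nA n(1) _ \<epsilon>])
      fix W assume W: "periodic W" "0 < measure M (A i \<inter> W)"
      then show "measure M (A i - W) = 0"
        using Y(3)[OF W(1), of i] by (simp add: cong1 cong2 periodic_sets)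
    qed (rule small)
  next
    fix i j assume "i < n" "j < n" "i \<noteq> j"
    then show "A i \<inter> A j \<in> null_sets M"
      using disj[of i j] disj[of j i] by (cases i j rule: linorder_cases) (auto simp: Int_commute)
  next
    have "(\<Union>j. pre j Z) = (\<Union>i<n. A i)"
    proof (intro equalityI UN_least)
      fix j show "pre j Z \<subseteq> (\<Union>i<n. A i)"
        using A_mod[of j] n(1) by (auto simp: A_def intro!: bexI[of _ "j mod n"])
    qed (auto simp: A_def)
    moreover have "0 < measure M Z" using measure_A[of 0] Y(2) by (simp add: A_def pre_0)
    ultimately show "space M - (\<Union>i<n. A i) \<in> null_sets M"
      using ergodic_cover[OF erg Z] by simp
  qed
qed

end

section \<open>Real codings of Lebesgue spaces\<close>

text \<open>A singleton has only trivial subsets, so with positive measure it would be an atom. This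
  disposes of the point masses of a Lebesgue space.\<close>

lemma non_atomic_singleton_null:
  assumes na: "non_atomic M" and x: "{x} \<in> sets M"
  shows "{x} \<in> null_sets M"
proof (rule ccontr)
  assume "{x} \<notin> null_sets M"
  then have "0 < emeasure M {x}" using x by (auto simp: null_sets_def zero_less_iff_neq_zero)
  moreover have "emeasure M B = 0 \<or> emeasure M ({x} - B) = 0" if "B \<subseteq> {x}" for B
    using that by (auto simp: subset_singleton_iff)
  ultimately show False using na x unfolding non_atomic_def by blast
qed

text \<open>An interval is convex, so it differs from its open interior by part of a negligible
  frontier.\<close>

lemma is_interval_sets_lebesgue:
  fixes I :: "real set"
  assumes "is_interval I"
  shows "I \<in> sets lebesgue"
proof -
  have "negligible (frontier I)"
    using assms is_interval_convex negligible_convex_frontier by blast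
  moreover have "I - interior I \<subseteq> frontier I" using closure_subset by (auto simp: frontier_def)
  ultimately have "I - interior I \<in> sets lebesgue"
    using negligible_subset negligible_imp_sets by blast
  moreover have "interior I \<in> sets lebesgue" by simp
  ultimately have "interior I \<union> (I - interior I) \<in> sets lebesgue" by (rule sets.Un[rotated])
  then show ?thesis using interior_subset[of I] by (simp add: Un_absorb1)
qed

text \<open>The coordinate \<open>f\<close> is the given isomorphism onto part of an interval. Since
  that interval carries the completed measure, a measurable set is described by Borel sets of
  coordinates only up to null sets, which the pair \<open>E\<close>, \<open>F\<close>
  records.\<close>

lemma lebesgue_space_coding:
  assumes M: "lebesgue_space M" "non_atomic M"
  obtains f :: "'a \<Rightarrow> real" and N where
    "f \<in> borel_measurable M" "N \<in> null_sets M" "inj_on f (space M - N)"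
    "\<forall>A\<in>sets M. \<exists>E\<in>sets borel. \<exists>F\<in>sets borel.
       f -` E \<inter> (space M - N) \<subseteq> A \<and> A \<inter> (space M - N) \<subseteq> f -` F \<and>
       f -` (F - E) \<inter> (space M - N) \<in> null_sets M"
proof -
  obtain C and I :: "real set" and N0 N1 \<phi> where C: "countable C" "C \<subseteq> space M" "\<And>x. x \<in> C \<Longrightarrow> {x} \<in> sets M"
    and I: "is_interval I"
    and iso: "isomorphism_mod_null (restrict_space M (space M - C)) (lebesgue_on I) N0 N1 \<phi>"
    using M(1) unfolding lebesgue_space_def by blast
  have "(\<Union>x\<in>C. {x}) \<in> null_sets M"
    using C by (intro null_sets_UN' non_atomic_singleton_null[OF M(2)]) auto
  then have C_null: "C \<in> null_sets M" by simp
  let ?M' = "restrict_space M (space M - C)"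
  define X X1 where "X = space ?M' - N0" and "X1 = space (lebesgue_on I) - N1"
  have \<phi>: "N0 \<in> null_sets ?M'" "N1 \<in> null_sets (lebesgue_on I)" "bij_betw \<phi> X X1"
    "\<phi> \<in> measurable (restrict_space ?M' X) (restrict_space (lebesgue_on I) X1)"
    "the_inv_into X \<phi> \<in> measurable (restrict_space (lebesgue_on I) X1) (restrict_space ?M' X)"
    "distr (restrict_space ?M' X) (restrict_space (lebesgue_on I) X1) \<phi>
      = restrict_space (lebesgue_on I) X1"
    using iso unfolding isomorphism_mod_null_def X_def X1_def Let_def by blast+
  have N0: "N0 \<in> null_sets M"
    using \<phi>(1) C_null by (subst (asm) null_sets_restrict_space) auto
  have X_eq: "X = space M - (C \<union> N0)" by (auto simp: X_def space_restrict_space)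
  have X_sets: "X \<in> sets M" using C_null N0 by (auto simp: X_eq)
  have restrict: "restrict_space ?M' X = restrict_space M X"
  proof -
    have "restrict_space ?M' X = restrict_space M ((space M - C) \<inter> X)"
      using C_null X_sets by (intro restrict_restrict_space) auto
    also have "(space M - C) \<inter> X = X" by (auto simp: X_eq)
    finally show ?thesis .
  qed
  have I_sets: "I \<in> sets lebesgue" using I by (rule is_interval_sets_lebesgue)
  have X1_sets: "X1 \<in> sets (lebesgue_on I)" using \<phi>(2) unfolding X1_def by blast
  then have X1: "X1 \<in> sets lebesgue" "X1 \<subseteq> I"
    using I_sets by (auto simp: sets_restrict_space_iff)
  have restrict1: "restrict_space (lebesgue_on I) X1 = lebesgue_on X1"
    using X1 I_sets by (subst restrict_restrict_space) (auto simp: Int_absorb1)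
  note \<phi> = \<phi>[unfolded restrict restrict1]
  have space_X: "space (restrict_space M X) = X"
    using X_sets sets.sets_into_space by (auto simp: space_restrict_space)
  define f where "f x = (if x \<in> X then \<phi> x else 0)" for x
  have \<phi>_meas: "\<phi> \<in> borel_measurable (restrict_space M X)"
  proof (rule measurable_compose[OF \<phi>(4), where g = "\<lambda>x. x"])
    show "(\<lambda>x. x) \<in> borel_measurable (lebesgue_on X1)"
      by (intro measurable_restrict_space1) (auto intro: measurable_completion)
  qed
  have "f \<in> borel_measurable M"
    unfolding f_def using X_sets \<phi>_meas sets.sets_into_space[OF X_sets]
    by (subst measurable_If_restrict_space_iff) (auto simp: Int_absorb2 conj_commute)
  moreover have "C \<union> N0 \<in> null_sets M" using C_null N0 by blast
  moreover have "inj_on f (space M - (C \<union> N0))"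
    using \<phi>(3) unfolding X_eq[symmetric] bij_betw_def by (auto simp: f_def inj_on_def)
  moreover have "\<forall>A\<in>sets M. \<exists>E\<in>sets borel. \<exists>F\<in>sets borel. f -` E \<inter> (space M - (C \<union> N0)) \<subseteq> A \<and>
      A \<inter> (space M - (C \<union> N0)) \<subseteq> f -` F \<and> f -` (F - E) \<inter> (space M - (C \<union> N0)) \<in> null_sets M"
  proof
    fix A assume A: "A \<in> sets M"
    \<comment> \<open>This is the image of \<open>A \<inter> X\<close>, written as a preimage under
      the inverse map so that measurability of the inverse applies.\<close>
    let ?D = "the_inv_into X \<phi> -` (A \<inter> X) \<inter> X1"
    have "A \<inter> X \<in> sets (restrict_space M X)"
      using A X_sets by (simp add: sets_restrict_space_iff)
    from measurable_sets[OF \<phi>(5) this] have "?D \<in> sets lebesgue"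
      using X1 by (simp add: space_restrict_space sets_restrict_space_iff)
    \<comment> \<open>A set of the completion is a Borel set \<open>S\<close> plus part of a Borel
      null set \<open>N''\<close>; the inner and outer sets are \<open>S\<close> and
      \<open>S \<union> N''\<close>.\<close>
    then obtain S N' N'' where S: "?D = S \<union> N'" "N' \<subseteq> N''" "N'' \<in> null_sets lborel" "S \<in> sets lborel"
      by (rule sets_completionE)
    have D_iff: "f x \<in> ?D \<longleftrightarrow> x \<in> A" if "x \<in> X" for x
      using that \<phi>(3) by (auto simp: f_def bij_betw_def the_inv_into_f_f)
    have "f -` (S \<union> N'' - S) \<inter> X \<in> null_sets M"
    proof (rule null_setsI)
      have N'': "N'' \<in> sets borel" using S(3) by auto
      let ?Q = "(S \<union> N'' - S) \<inter> X1"
      have Q: "?Q \<in> sets (lebesgue_on X1)"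
        using S N'' X1 by (auto simp: sets_restrict_space_iff)
      have "f -` (S \<union> N'' - S) \<inter> X = \<phi> -` ?Q \<inter> space (restrict_space M X)"
        using \<phi>(3) by (auto simp: space_X f_def bij_betw_def)
      then have "emeasure M (f -` (S \<union> N'' - S) \<inter> X)
          = emeasure (restrict_space M X) (\<phi> -` ?Q \<inter> space (restrict_space M X))"
        using X_sets by (simp add: emeasure_restrict_space space_X)
      also have "\<dots> = emeasure (lebesgue_on X1) ?Q"
        using \<phi>(4,6) Q by (metis emeasure_distr)
      also have "\<dots> = emeasure lebesgue ?Q"
        using X1 by (subst emeasure_restrict_space) auto
      also have "\<dots> \<le> emeasure lebesgue N''"
        using N'' by (intro emeasure_mono) auto
      also have "\<dots> = 0" by (rule null_setsD1[OF null_sets_completionI[OF S(3)]])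
      finally show "emeasure M (f -` (S \<union> N'' - S) \<inter> X) = 0" by simp
      show "f -` (S \<union> N'' - S) \<inter> X \<in> sets M"
      proof -
        have "f -` (S \<union> N'' - S) \<inter> space M \<in> sets M"
          using \<open>f \<in> borel_measurable M\<close> S N'' by (intro measurable_sets[of f M borel]) auto
        then have "(f -` (S \<union> N'' - S) \<inter> space M) \<inter> X \<in> sets M" using X_sets by blast
        moreover have "(f -` (S \<union> N'' - S) \<inter> space M) \<inter> X = f -` (S \<union> N'' - S) \<inter> X"
          using sets.sets_into_space[OF X_sets] by blast
        ultimately show ?thesis by simp
      qed
    qed
    moreover have "f -` S \<inter> X \<subseteq> A" using D_iff S(1) by blast
    moreover have "A \<inter> X \<subseteq> f -` (S \<union> N'')"
    proof
      fix x assume x: "x \<in> A \<inter> X"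
      then have "f x \<in> ?D" using D_iff[of x] by blast
      then show "x \<in> f -` (S \<union> N'')" using S(1,2) by blast
    qed
    moreover have "S \<in> sets borel" "S \<union> N'' \<in> sets borel" using S(3,4) by auto
    ultimately show "\<exists>E\<in>sets borel. \<exists>F\<in>sets borel. f -` E \<inter> (space M - (C \<union> N0)) \<subseteq> A \<and>
        A \<inter> (space M - (C \<union> N0)) \<subseteq> f -` F \<and> f -` (F - E) \<inter> (space M - (C \<union> N0)) \<in> null_sets M"
      unfolding X_eq[symmetric] by blast
  qed
  ultimately show ?thesis by (rule that)
qed

section \<open>Metrics from separating families\<close>

definition agree :: "(nat \<Rightarrow> 'a set) \<Rightarrow> nat \<Rightarrow> 'a \<Rightarrow> 'a \<Rightarrow> bool" where
  "agree V n x y \<longleftrightarrow> (\<forall>m<n. x \<in> V m \<longleftrightarrow> y \<in> V m)"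

text \<open>This is a metric of Cantor space pulled back along the map that sends a point to its
  memberships in the sets \<open>V n\<close>; \<open>Suc\<close> keeps the value defined when the
  first set already separates.\<close>

definition separation_dist :: "(nat \<Rightarrow> 'a set) \<Rightarrow> 'a \<Rightarrow> 'a \<Rightarrow> real" where
  "separation_dist V x y =
     (if \<forall>n. x \<in> V n \<longleftrightarrow> y \<in> V n then 0
      else inverse (real (Suc (LEAST n. \<not> (x \<in> V n \<longleftrightarrow> y \<in> V n)))))"

lemma separation_dist_less_iff:
  "separation_dist V x y < inverse (real (Suc n)) \<longleftrightarrow> agree V (Suc n) x y"
proof (cases "\<forall>n. x \<in> V n \<longleftrightarrow> y \<in> V n")
  case True
  then show ?thesis by (simp add: separation_dist_def agree_def)
next
  case False
  define l where "l = (LEAST n. \<not> (x \<in> V n \<longleftrightarrow> y \<in> V n))"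
  have l: "\<not> (x \<in> V l \<longleftrightarrow> y \<in> V l)" "\<And>m. m < l \<Longrightarrow> x \<in> V m \<longleftrightarrow> y \<in> V m"
    using LeastI_ex[of "\<lambda>n. \<not> (x \<in> V n \<longleftrightarrow> y \<in> V n)"] False not_less_Least
    unfolding l_def by blast+
  have "separation_dist V x y = inverse (real (Suc l))"
    using False by (simp add: separation_dist_def l_def)
  then have "separation_dist V x y < inverse (real (Suc n)) \<longleftrightarrow> n < l"
    by (simp add: inverse_less_iff_less)
  also have "\<dots> \<longleftrightarrow> agree V (Suc n) x y"
    using l unfolding agree_def by (metis less_Suc_eq_le less_le_trans not_le)
  finally show ?thesis .
qed

lemma separation_dist_nonneg: "0 \<le> separation_dist V x y"
  by (simp add: separation_dist_def)

lemma separation_dist_ge: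
  "\<not> (x \<in> V n \<longleftrightarrow> y \<in> V n) \<Longrightarrow> inverse (real (Suc n)) \<le> separation_dist V x y"
  using separation_dist_less_iff[of V x y n] by (meson agree_def lessI not_le)

text \<open>For the triangle inequality, the first set separating \<open>x\<close> from
  \<open>z\<close> also separates \<open>y\<close> from one of them, so one of the two distances is
  already large enough.\<close>

lemma Metric_space_separation_dist:
  assumes sep: "\<And>x y. x \<in> X \<Longrightarrow> y \<in> X \<Longrightarrow> (\<And>n. x \<in> V n \<longleftrightarrow> y \<in> V n) \<Longrightarrow> x = y"
  shows "Metric_space X (separation_dist V)"
proof
  fix x y z
  show "separation_dist V x y = separation_dist V y x"
    unfolding separation_dist_def by (simp add: eq_commute)
  show "separation_dist V x y = 0 \<longleftrightarrow> x = y" if "x \<in> X" "y \<in> X"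
    using sep[OF that] by (auto simp: separation_dist_def)
  show "separation_dist V x z \<le> separation_dist V x y + separation_dist V y z"
  proof (cases "\<forall>n. x \<in> V n \<longleftrightarrow> z \<in> V n")
    case True
    then show ?thesis using separation_dist_nonneg[of V] by (simp add: separation_dist_def)
  next
    case False
    define l where "l = (LEAST n. \<not> (x \<in> V n \<longleftrightarrow> z \<in> V n))"
    have "\<not> (x \<in> V l \<longleftrightarrow> z \<in> V l)"
      using LeastI_ex[of "\<lambda>n. \<not> (x \<in> V n \<longleftrightarrow> z \<in> V n)"] False unfolding l_def by blast
    then have "\<not> (x \<in> V l \<longleftrightarrow> y \<in> V l) \<or> \<not> (y \<in> V l \<longleftrightarrow> z \<in> V l)" by blast
    then have "inverse (real (Suc l)) \<le> separation_dist V x y + separation_dist V y z"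
      using separation_dist_ge[of x V l y] separation_dist_ge[of y V l z]
        separation_dist_nonneg[of V x y] separation_dist_nonneg[of V y z] by linarith
    moreover have "separation_dist V x z = inverse (real (Suc l))"
      using False by (simp add: separation_dist_def l_def)
    ultimately show ?thesis by simp
  qed
qed (rule separation_dist_nonneg)

section \<open>Cylinders, and goodness of the separation metric\<close>

text \<open>Indexing by a number and a finite set, instead of by a point, shows that there are only
  countably many cylinders.\<close>

definition cylinder :: "'a measure \<Rightarrow> (nat \<Rightarrow> 'a set) \<Rightarrow> nat \<Rightarrow> nat set \<Rightarrow> 'a set" where
  "cylinder M V n P = {y \<in> space M. \<forall>m<n. y \<in> V m \<longleftrightarrow> m \<in> P}"

lemma cylinder_sets [measurable]:
  assumes V: "\<And>n. V n \<inter> space M \<in> sets M"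
  shows "cylinder M V n P \<in> sets M"
proof -
  have "{y \<in> space M. y \<in> V m \<longleftrightarrow> m \<in> P} \<in> sets M" for m
  proof (cases "m \<in> P")
    case True
    then have "{y \<in> space M. y \<in> V m \<longleftrightarrow> m \<in> P} = V m \<inter> space M" by blast
    then show ?thesis using V by simp
  next
    case False
    then have "{y \<in> space M. y \<in> V m \<longleftrightarrow> m \<in> P} = space M - V m \<inter> space M" by blast
    then show ?thesis using V by (simp add: sets.compl_sets)
  qed
  then have "{y \<in> space M. \<forall>m\<in>{..<n}. y \<in> V m \<longleftrightarrow> m \<in> P} \<in> sets M"
    by (intro sets.sets_Collect_finite_All) auto
  then show ?thesis by (simp only: cylinder_def Ball_def lessThan_iff)
qed

lemma agree_cylinder:
  "x \<in> space M \<Longrightarrow> {y \<in> space M. agree V n x y} = cylinder M V n {m \<in> {..<n}. x \<in> V m}"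
  by (auto simp: cylinder_def agree_def)

text \<open>Here \<open>cylinder_pos\<close> makes nonempty open sets non-null, and
  \<open>enclosed\<close> extends regularity from the sigma-algebra generated by \<open>V\<close> to
  all measurable sets.\<close>

locale separating_family = finite_measure M for M :: "'a measure" +
  fixes V :: "nat \<Rightarrow> 'a set"
  assumes V_sets: "V n \<inter> space M \<in> sets M"
    and separating: "x \<in> space M \<Longrightarrow> y \<in> space M \<Longrightarrow> (\<And>n. x \<in> V n \<longleftrightarrow> y \<in> V n) \<Longrightarrow> x = y"
    and cylinder_pos: "x \<in> space M \<Longrightarrow> 0 < emeasure M {y \<in> space M. agree V n x y}"
    and enclosed: "A \<in> sets M \<Longrightarrow>
      \<exists>E\<in>sigma_sets (space M) (range (\<lambda>n. V n \<inter> space M)).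
      \<exists>F\<in>sigma_sets (space M) (range (\<lambda>n. V n \<inter> space M)).
        E \<subseteq> A \<and> A \<subseteq> F \<and> F - E \<in> null_sets M"
begin

sublocale Metric_space "space M" "separation_dist V"
  using separating by (rule Metric_space_separation_dist)

lemma mball_agree: "x \<in> space M \<Longrightarrow> mball x (inverse (real (Suc n))) = {y \<in> space M. agree V (Suc n) x y}"
  by (auto simp: mball_def separation_dist_less_iff simp del: of_nat_Suc)

lemma ex_agree_subset_mball:
  assumes "x \<in> space M" "0 < e"
  shows "\<exists>n. {y \<in> space M. agree V n x y} \<subseteq> mball x e"
proof -
  obtain n where "inverse (real (Suc n)) < e" using reals_Archimedean assms(2) by blast
  then have "mball x (inverse (real (Suc n))) \<subseteq> mball x e" by (intro mball_subset_concentric) simp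
  then show ?thesis using mball_agree[OF assms(1)] by blast
qed

lemma open_iff:
  "openin mtopology U \<longleftrightarrow> U \<subseteq> space M \<and> (\<forall>x\<in>U. \<exists>n. {y \<in> space M. agree V n x y} \<subseteq> U)"
proof
  assume U: "openin mtopology U"
  then have "U \<subseteq> space M" by (simp add: openin_mtopology)
  moreover have "\<exists>n. {y \<in> space M. agree V n x y} \<subseteq> U" if "x \<in> U" for x
  proof -
    from U that obtain e where "e > 0" "mball x e \<subseteq> U" unfolding openin_mtopology by blast
    then show ?thesis using ex_agree_subset_mball[of x e] \<open>U \<subseteq> space M\<close> that by blast
  qed
  ultimately show "U \<subseteq> space M \<and> (\<forall>x\<in>U. \<exists>n. {y \<in> space M. agree V n x y} \<subseteq> U)" by blast
next
  assume U: "U \<subseteq> space M \<and> (\<forall>x\<in>U. \<exists>n. {y \<in> space M. agree V n x y} \<subseteq> U)"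
  have "\<exists>e>0. mball x e \<subseteq> U" if x: "x \<in> U" for x
  proof -
    obtain n where n: "{y \<in> space M. agree V n x y} \<subseteq> U" using U x by blast
    have "mball x (inverse (real (Suc n))) \<subseteq> {y \<in> space M. agree V n x y}"
      using U x by (subst mball_agree) (auto simp: agree_def)
    then show ?thesis using n by (intro exI[of _ "inverse (real (Suc n))"]) auto
  qed
  then show "openin mtopology U" using U by (simp add: openin_mtopology)
qed

text \<open>Agreement on the first \<open>Suc n\<close> sets decides membership in
  \<open>V n\<close>, so the generators are open and, likewise, closed; each is its own
  approximation.\<close>

lemma open_V: "openin mtopology (V n \<inter> space M)"
  unfolding open_iff by (auto simp: agree_def intro!: exI[of _ "Suc n"])

lemma closed_V: "closedin mtopology (V n \<inter> space M)"
proof -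
  have "openin mtopology (space M - V n \<inter> space M)"
    unfolding open_iff by (auto simp: agree_def intro!: exI[of _ "Suc n"])
  then show ?thesis by (simp add: closedin_def)
qed

text \<open>An open set is the union of the cylinders inside it, and these are countably
  many.\<close>

lemma open_sets:
  assumes U: "openin mtopology U"
  shows "U \<in> sets M"
proof -
  let ?K = "{(n, P). finite P \<and> cylinder M V n P \<subseteq> U}"
  have "countable (UNIV \<times> Collect finite :: (nat \<times> nat set) set)"
    by (intro countable_SIGMA countable_Collect_finite) auto
  then have K: "countable ?K" by (rule countable_subset[rotated]) auto
  have "U = (\<Union>(n, P)\<in>?K. cylinder M V n P)"
  proof (intro equalityI subsetI)
    fix x assume x: "x \<in> U"
    then have xs: "x \<in> space M" using U by (auto simp: open_iff)
    from U x obtain n where n: "{y \<in> space M. agree V n x y} \<subseteq> U" unfolding open_iff by blast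
    let ?P = "{m \<in> {..<n}. x \<in> V m}"
    have "cylinder M V n ?P \<subseteq> U" using n agree_cylinder[OF xs] by metis
    moreover have "x \<in> cylinder M V n ?P" using xs by (auto simp: cylinder_def)
    ultimately show "x \<in> (\<Union>(n, P)\<in>?K. cylinder M V n P)" by (intro UN_I[of "(n, ?P)"]) auto
  qed auto
  also have "\<dots> \<in> sets M"
    using K by (intro sets.countable_UN') (auto intro: cylinder_sets V_sets)
  finally show ?thesis .
qed

lemma closed_sets: "closedin mtopology F \<Longrightarrow> F \<in> sets M"
  using open_sets[of "space M - F"] unfolding closedin_def topspace_mtopology
  by (metis Diff_Diff_Int inf.absorb_iff2 sets.compl_sets)

definition approximable :: "'a set \<Rightarrow> bool" where
  "approximable A \<longleftrightarrow> (\<forall>e>0. \<exists>F U. closedin mtopology F \<and> openin mtopology U \<and>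
     F \<subseteq> A \<and> A \<subseteq> U \<and> measure M (U - F) < e)"

text \<open>Geometrically decreasing errors use up \<open>e / 2\<close>. An infinite union of closed
  sets need not be closed, so it is cut off at a finite stage, at the cost of another
  \<open>e / 2\<close>.\<close>

lemma approximable_UN:
  assumes A: "\<And>i. approximable (A i)"
  shows "approximable (\<Union>i::nat. A i)"
  unfolding approximable_def
proof (intro allI impI)
  fix e :: real assume e: "0 < e"
  have "\<exists>F U. closedin mtopology F \<and> openin mtopology U \<and> F \<subseteq> A i \<and> A i \<subseteq> U \<and>
      measure M (U - F) < e / 2 * (1/2) ^ Suc i" for i
  proof -
    have "0 < e / 2 * (1/2) ^ Suc i" using e by simp
    then show ?thesis using A[of i] unfolding approximable_def by blast
  qed
  then obtain F U where FU: "\<And>i. closedin mtopology (F i)" "\<And>i. openin mtopology (U i)"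
    "\<And>i. F i \<subseteq> A i" "\<And>i. A i \<subseteq> U i" "\<And>i. measure M (U i - F i) < e / 2 * (1/2) ^ Suc i"
    by metis
  have [measurable]: "F i \<in> sets M" "U i \<in> sets M" for i
    using FU by (auto intro: closed_sets open_sets)
  have "(\<lambda>k. measure M (\<Union>i<k. F i)) \<longlonglongrightarrow> measure M (\<Union>k. \<Union>i<k. F i)"
    by (intro finite_Lim_measure_incseq) (auto simp: incseq_def intro: less_le_trans)
  also have "(\<Union>k. \<Union>i<k. F i) = (\<Union>i. F i)" by auto
  finally have "eventually (\<lambda>k. measure M (\<Union>i. F i) - e / 2 < measure M (\<Union>i<k. F i)) sequentially"
    using e by (intro order_tendstoD(1)) auto
  then obtain k where k: "measure M (\<Union>i. F i) - e / 2 < measure M (\<Union>i<k. F i)"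
    by (auto simp: eventually_sequentially)
  have "measure M ((\<Union>i. F i) - (\<Union>i<k. F i)) = measure M (\<Union>i. F i) - measure M (\<Union>i<k. F i)"
    by (intro finite_measure_Diff) auto
  with k have rest: "measure M ((\<Union>i. F i) - (\<Union>i<k. F i)) < e / 2" by simp
  have sums: "(\<lambda>i. e / 2 * (1/2) ^ Suc i) sums (e / 2 * 1)"
    by (intro sums_mult power_half_series)
  have summ: "summable (\<lambda>i. measure M (U i - F i))"
    using FU(5) by (intro summable_comparison_test'[OF sums_summable[OF sums]]) (simp add: less_imp_le)
  have "measure M (\<Union>i. U i - F i) \<le> (\<Sum>i. measure M (U i - F i))"
    using summ by (intro finite_measure_subadditive_countably) auto
  also have "\<dots> \<le> (\<Sum>i. e / 2 * (1/2) ^ Suc i)"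
    using FU(5) by (intro suminf_le summ sums_summable[OF sums]) (simp add: less_imp_le)
  also have "\<dots> = e / 2" using sums_unique[OF sums] by simp
  finally have main: "measure M (\<Union>i. U i - F i) \<le> e / 2" .
  have "measure M ((\<Union>i. U i) - (\<Union>i<k. F i))
      \<le> measure M ((\<Union>i. U i - F i) \<union> ((\<Union>i. F i) - (\<Union>i<k. F i)))"
    by (intro finite_measure_mono) auto
  also have "\<dots> \<le> measure M (\<Union>i. U i - F i) + measure M ((\<Union>i. F i) - (\<Union>i<k. F i))"
    by (intro measure_Un_le) auto
  also have "\<dots> < e" using main rest by simp
  finally have "measure M ((\<Union>i. U i) - (\<Union>i<k. F i)) < e" .
  moreover have "closedin mtopology (\<Union>i<k. F i)" using FU(1) by (intro closedin_Union) auto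
  moreover have "openin mtopology (\<Union>i. U i)" using FU(2) by blast
  moreover have "(\<Union>i<k. F i) \<subseteq> (\<Union>i. A i)" "(\<Union>i. A i) \<subseteq> (\<Union>i. U i)" using FU(3,4) by blast+
  ultimately show "\<exists>F U. closedin mtopology F \<and> openin mtopology U \<and> F \<subseteq> (\<Union>i. A i) \<and>
      (\<Union>i. A i) \<subseteq> U \<and> measure M (U - F) < e"
    by blast
qed

lemma approximable_sigma_sets:
  assumes "A \<in> sigma_sets (space M) (range (\<lambda>n. V n \<inter> space M))"
  shows "approximable A"
  using assms
proof (induction rule: sigma_sets.induct)
  case (Basic A)
  then obtain n where n: "A = V n \<inter> space M" by blast
  show ?case
    unfolding approximable_def n using open_V closed_V
    by (intro allI impI exI[of _ "V n \<inter> space M"]) auto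
next
  case Empty
  show ?case
    unfolding approximable_def by (intro allI impI exI[of _ "{}"]) auto
next
  case (Compl A)
  show ?case
    unfolding approximable_def
  proof (intro allI impI)
    fix e :: real assume e: "0 < e"
    from Compl.IH[unfolded approximable_def, rule_format, OF e]
    obtain F U where FU: "closedin mtopology F" "openin mtopology U" "F \<subseteq> A" "A \<subseteq> U"
      "measure M (U - F) < e" by blast
    have "U \<subseteq> space M" using FU(2) by (simp add: openin_mtopology)
    then have "(space M - F) - (space M - U) = U - F" by blast
    then have "measure M ((space M - F) - (space M - U)) < e" using FU(5) by simp
    moreover have "closedin mtopology (space M - U)" using closedin_diff[OF closedin_topspace FU(2)] by simp
    moreover have "openin mtopology (space M - F)" using FU(1) by (simp add: closedin_def)
    moreover have "space M - U \<subseteq> space M - A" "space M - A \<subseteq> space M - F" using FU(3,4) by blast+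
    ultimately show "\<exists>F' U'. closedin mtopology F' \<and> openin mtopology U' \<and> F' \<subseteq> space M - A \<and>
        space M - A \<subseteq> U' \<and> measure M (U' - F') < e"
      by blast
  qed
next
  case (Union A)
  then show ?case by (intro approximable_UN) auto
qed

text \<open>The closed set is taken from the inner set \<open>E\<close> and the open set from the
  outer set \<open>G\<close>, whose difference is null.\<close>

lemma approximable_measurable:
  assumes A: "A \<in> sets M"
  shows "approximable A"
  unfolding approximable_def
proof (intro allI impI)
  fix e :: real assume e: "0 < e"
  obtain E G where EG: "approximable E" "approximable G" "E \<subseteq> A" "A \<subseteq> G" "G - E \<in> null_sets M"
    using enclosed[OF A] approximable_sigma_sets by blast
  from EG(1)[unfolded approximable_def, rule_format, OF half_gt_zero[OF e]]
  obtain F1 U1 where 1: "closedin mtopology F1" "openin mtopology U1" "F1 \<subseteq> E" "E \<subseteq> U1"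
    "measure M (U1 - F1) < e / 2" by blast
  from EG(2)[unfolded approximable_def, rule_format, OF half_gt_zero[OF e]]
  obtain F2 U2 where 2: "closedin mtopology F2" "openin mtopology U2" "F2 \<subseteq> G" "G \<subseteq> U2"
    "measure M (U2 - F2) < e / 2" by blast
  have [measurable]: "F1 \<in> sets M" "F2 \<in> sets M" "U1 \<in> sets M" "U2 \<in> sets M" "G - E \<in> sets M"
    using 1 2 EG(5) by (auto intro: closed_sets open_sets)
  have "measure M (U2 - F1) \<le> measure M ((U2 - F2) \<union> (U1 - F1) \<union> (G - E))"
    using 1 2 by (intro finite_measure_mono) auto
  also have "\<dots> \<le> measure M ((U2 - F2) \<union> (U1 - F1)) + measure M (G - E)"
    by (intro measure_Un_le) auto
  also have "\<dots> \<le> measure M (U2 - F2) + measure M (U1 - F1) + measure M (G - E)"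
    by (intro add_right_mono measure_Un_le) auto
  also have "\<dots> < e" using 1(5) 2(5) measure_eq_0_null_sets[OF EG(5)] by simp
  finally show "\<exists>F U. closedin mtopology F \<and> openin mtopology U \<and> F \<subseteq> A \<and> A \<subseteq> U \<and>
      measure M (U - F) < e"
    using 1 2 EG by (intro exI[of _ F1] exI[of _ U2]) auto
qed

theorem good_metric_separation_dist: "good_metric M (separation_dist V)"
  unfolding good_metric_def regular_measure_def
proof (intro conjI allI impI ballI)
  show "Metric_space (space M) (separation_dist V)" by (rule Metric_space_axioms)
  show "U \<in> sets M" if "openin mtopology U" for U using that by (rule open_sets)
next
  fix A and e :: ennreal assume A: "A \<in> sets M" and e: "0 < e"
  \<comment> \<open>Regularity admits an infinite tolerance, which is replaced by 1.\<close>
  obtain r :: real where r: "0 < r" "ennreal r \<le> e"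
  proof (cases e)
    case (real r)
    then show ?thesis using e that by auto
  next
    case top
    then show ?thesis using that[of 1] by simp
  qed
  from approximable_measurable[OF A, unfolded approximable_def, rule_format, OF r(1)]
  obtain F U where FU: "closedin mtopology F" "openin mtopology U" "F \<subseteq> A" "A \<subseteq> U"
    "measure M (U - F) < r" by blast
  have "emeasure M (U - F) < ennreal r"
    using FU(5) r(1) by (simp add: emeasure_eq_measure ennreal_less_iff)
  then show "\<exists>F U. closedin mtopology F \<and> openin mtopology U \<and> F \<subseteq> A \<and> A \<subseteq> U \<and> emeasure M (U - F) < e"
    using FU r(2) by (meson less_le_trans)
next
  fix U assume U: "openin mtopology U" "U \<noteq> {}"
  then obtain x n where x: "x \<in> U" "{y \<in> space M. agree V n x y} \<subseteq> U"
    unfolding open_iff by blast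
  have "x \<in> space M" using U x by (auto simp: open_iff)
  then have "0 < emeasure M {y \<in> space M. agree V n x y}" by (rule cylinder_pos)
  also have "\<dots> \<le> emeasure M U" using x(2) open_sets[OF U(1)] by (intro emeasure_mono) auto
  finally show "0 < emeasure M U" .
qed

end

section \<open>A lower bound from measurable sensitivity\<close>

lemma isomorphic_systems_restrict:
  assumes X: "X \<in> sets M" "space M - X \<in> null_sets M" "T ` X \<subseteq> X"
  shows "isomorphic_systems M T (restrict_space M X) T"
proof -
  have sub: "X \<subseteq> space M" using X sets.sets_into_space by blast
  have space: "space (restrict_space M X) = X" using sub by (auto simp: space_restrict_space)
  have XX: "space M - (space M - X) = X" using sub by blast
  have rr: "restrict_space (restrict_space M X) X = restrict_space M X"
    using X by (subst restrict_restrict_space) auto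
  have inv: "the_inv_into X id \<in> measurable (restrict_space M X) (restrict_space M X)"
    by (subst measurable_cong[where g = id]) (auto simp: space the_inv_into_f_f[of id, simplified])
  have distr: "distr (restrict_space M X) (restrict_space M X) id = restrict_space M X"
    by (simp add: id_def)
  have "isomorphism_mod_null M (restrict_space M X) (space M - X) {} id"
    unfolding isomorphism_mod_null_def Let_def XX space Diff_empty rr
    using X inv distr by auto
  then show ?thesis
    unfolding isomorphic_systems_def using X(3) XX space
    by (intro exI[of _ "space M - X"] exI[of _ "{}"] exI[of _ id]) simp
qed

context finite_mpt
begin

text \<open>The separating family consists of the sets \<open>G i - U j\<close> for a countable collection of sets \<open>G i\<close>,
  enumerated such that the index of \<open>G i - U j\<close> is at least \<open>j\<close>. Since \<open>U\<close> decreases, a set of index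
  at most \<open>k\<close> does not meet \<open>U (Suc k)\<close> and hence does not separate any two of its points.\<close>

lemma ex_good_metric:
  fixes f :: "'a \<Rightarrow> real" and B U :: "nat \<Rightarrow> 'a set"
  assumes f: "f \<in> borel_measurable M" "N \<in> null_sets M" "inj_on f (space M - N)"
    and enclosed: "\<forall>A\<in>sets M. \<exists>E\<in>sets borel. \<exists>F\<in>sets borel.
       f -` E \<inter> (space M - N) \<subseteq> A \<and> A \<inter> (space M - N) \<subseteq> f -` F \<and>
       f -` (F - E) \<inter> (space M - N) \<in> null_sets M"
    and B: "\<And>k. B k \<in> sets M"
    and U: "\<And>k. U k \<in> sets M" "decseq U" "(\<Inter>k. U k) \<in> null_sets M"
  obtains X d where "X \<in> sets M" "space M - X \<in> null_sets M" "T ` X \<subseteq> X"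
    "good_metric (restrict_space M X) d"
    "\<forall>k. \<forall>x\<in>U (Suc k). \<forall>y\<in>U (Suc k). d x y < inverse (real (Suc k))"
    "\<forall>k. \<forall>x\<in>X \<inter> B k. \<exists>e>0. \<forall>y\<in>X. d x y < e \<longrightarrow> y \<in> B k"
proof -
  \<comment> \<open>The rational sublevel sets of \<open>f\<close> separate points and recover Borel
    sets of coordinates; the sets \<open>B k\<close> are included so that they become open on
    \<open>X\<close>.\<close>
  define \<G> where "\<G> = insert (space M) (range B \<union> range (\<lambda>q::rat. {x \<in> space M. f x < of_rat q}))"
  have \<G>: "countable \<G>" "\<G> \<noteq> {}" unfolding \<G>_def by auto
  define G where "G = from_nat_into \<G>"
  have range_G: "range G = \<G>" unfolding G_def using \<G> by (rule range_from_nat_into[rotated])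
  have f_sets: "{x \<in> space M. f x < a} \<in> sets M" for a
    using f(1) by (simp add: borel_measurable_iff_less)
  have "\<G> \<subseteq> sets M" unfolding \<G>_def using B f_sets by auto
  then have G_sets: "G i \<in> sets M" for i using range_G by blast
  define V where "V m = (case prod_decode m of (i, j) \<Rightarrow> G i - U j)" for m
  have V_encode: "V (prod_encode (i, j)) = G i - U j" for i j by (simp add: V_def)
  have V_sets: "V m \<in> sets M" for m
    unfolding V_def using G_sets U(1) by (auto split: prod.split)
  have V_sets': "V m \<inter> space M \<in> sets M" for m using V_sets by auto
  \<comment> \<open>Removing all null cylinders, countably many, leaves every cylinder through a
    remaining point with positive measure.\<close>
  define Z where "Z = (\<Union>(n, P)\<in>{(n, P). finite P \<and> cylinder M V n P \<in> null_sets M}. cylinder M V n P)"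
  have "countable (UNIV \<times> Collect finite :: (nat \<times> nat set) set)"
    by (intro countable_SIGMA countable_Collect_finite) auto
  then have "countable {(n, P). finite P \<and> cylinder M V n P \<in> null_sets M}"
    by (rule countable_subset[rotated]) auto
  then have "Z \<in> null_sets M" unfolding Z_def by (intro null_sets_UN') auto
  then have Bad: "N \<union> (\<Inter>k. U k) \<union> Z \<in> null_sets M" using f(2) U(3) by blast
  let ?Bad = "N \<union> (\<Inter>k. U k) \<union> Z"
  \<comment> \<open>All preimages of the bad set are removed, so that \<open>T\<close> maps
    \<open>X\<close> into itself.\<close>
  define X where "X = space M - (\<Union>n. pre n ?Bad)"
  have bad_null: "(\<Union>n. pre n ?Bad) \<in> null_sets M" using Bad pre_null by blast
  have X_sets: "X \<in> sets M" unfolding X_def using bad_null by auto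
  have X_sub: "X \<subseteq> space M" by (auto simp: X_def)
  have X_null: "space M - X \<in> null_sets M"
    by (rule null_sets_subset[OF bad_null]) (use X_sets in \<open>auto simp: X_def\<close>)
  have X_good: "x \<notin> ?Bad" if "x \<in> X" for x
    using that pre_0[of ?Bad] Bad unfolding X_def by blast
  have X_inv: "T ` X \<subseteq> X"
  proof
    fix y assume "y \<in> T ` X"
    then obtain x where x: "x \<in> X" "y = T x" by blast
    have "y \<in> space M" using x X_sub space_funpow[of x 1] by auto
    moreover have "y \<notin> pre n ?Bad" for n
    proof
      assume "y \<in> pre n ?Bad"
      then have "x \<in> pre (Suc n) ?Bad"
        using x X_sub unfolding pre_def by (auto simp: funpow_swap1)
      then show False using x(1) unfolding X_def by blast
    qed
    ultimately show "y \<in> X" unfolding X_def by blast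
  qed
  let ?M = "restrict_space M X"
  have space_X: "space ?M = X" using X_sub by (auto simp: space_restrict_space)
  have sets_X: "A \<in> sets ?M \<longleftrightarrow> A \<in> sets M \<and> A \<subseteq> X" for A
    using X_sets X_sub by (auto simp: sets_restrict_space_iff Int_absorb2)
  have off_U: "\<exists>j. x \<notin> U j" if "x \<in> X" for x using X_good[OF that] by blast
  \<comment> \<open>Every point of \<open>X\<close> lies outside some \<open>U j\<close>, so no
    information about \<open>G i\<close> is lost on \<open>X\<close> by subtracting the sets
    \<open>U j\<close>.\<close>
  have G_X: "G i \<inter> X = (\<Union>j. V (prod_encode (i, j)) \<inter> X)" for i
    using off_U by (auto simp: V_encode)
  interpret R: finite_measure ?M
    using X_sets by (intro finite_measure_restrict_space finite_measure_axioms) auto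
  have "separating_family ?M V"
  proof
    show "V n \<inter> space ?M \<in> sets ?M" for n using V_sets X_sets by (auto simp: space_X sets_X)
  next
    fix x y assume xy: "x \<in> space ?M" "y \<in> space ?M" and same: "\<And>n. x \<in> V n \<longleftrightarrow> y \<in> V n"
    have G_same: "x \<in> G i \<longleftrightarrow> y \<in> G i" for i
      using G_X[of i] xy same unfolding space_X by blast
    have "f x < of_rat q \<longleftrightarrow> f y < of_rat q" for q
    proof -
      have "{x \<in> space M. f x < of_rat q} \<in> range G" unfolding range_G by (simp add: \<G>_def)
      then obtain i where i: "G i = {x \<in> space M. f x < of_rat q}" by (metis rangeE)
      show ?thesis using G_same[of i] xy X_sub unfolding space_X i by blast
    qed
    then have "f x = f y"
      by (metis less_irrefl linorder_neqE_linordered_idom less_trans of_rat_dense)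
    then show "x = y" using f(3) xy X_good X_sub unfolding space_X inj_on_def by blast
  next
    fix x n assume x: "x \<in> space ?M"
    let ?P = "{m \<in> {..<n}. x \<in> V m}"
    have xM: "x \<in> space M" using x X_sub by (auto simp: space_X)
    have "x \<in> cylinder M V n ?P" using xM by (auto simp: cylinder_def)
    moreover have "x \<notin> Z" using X_good x by (auto simp: space_X)
    ultimately have pos: "cylinder M V n ?P \<notin> null_sets M" unfolding Z_def by fastforce
    have cyl: "cylinder M V n ?P \<in> sets M" using V_sets' by (rule cylinder_sets)
    have "{y \<in> space ?M. agree V n x y} = cylinder M V n ?P \<inter> X"
      using agree_cylinder[OF xM, of V n] X_sub unfolding space_X by blast
    then have "emeasure ?M {y \<in> space ?M. agree V n x y} = emeasure M (cylinder M V n ?P \<inter> X)"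
      using X_sets by (simp add: emeasure_restrict_space)
    also have "\<dots> = emeasure M (cylinder M V n ?P)"
      using AE_not_in[OF X_null] AE_space cyl X_sets by (intro emeasure_eq_AE) auto
    finally show "0 < emeasure ?M {y \<in> space ?M. agree V n x y}"
      using pos cyl by (auto simp: null_sets_def zero_less_iff_neq_zero)
  next
    fix A assume "A \<in> sets ?M"
    then have A: "A \<in> sets M" "A \<subseteq> X" by (auto simp: sets_X)
    obtain E F where EF: "E \<in> sets borel" "F \<in> sets borel" "f -` E \<inter> (space M - N) \<subseteq> A"
      "A \<inter> (space M - N) \<subseteq> f -` F" "f -` (F - E) \<inter> (space M - N) \<in> null_sets M"
      using bspec[OF enclosed A(1)] by blast
    let ?\<V> = "range (\<lambda>n. V n \<inter> space ?M)"
    define S where "S = sigma X ?\<V>"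
    have V_sub: "?\<V> \<subseteq> Pow X" by (auto simp: space_X)
    have S: "space S = X" "sets S = sigma_sets X ?\<V>"
      unfolding S_def using V_sub by (auto simp: space_measure_of)
    have V_S: "V n \<inter> X \<in> sets S" for n unfolding S space_X by (rule sigma_sets.Basic) blast
    have G_S: "G i \<inter> X \<in> sets S" for i unfolding G_X by (intro sets.countable_UN'' V_S) auto
    have "{x \<in> space S. f x < a} \<in> sets S" for a
    proof -
      have rat: "{x \<in> X. f x < of_rat q} \<in> sets S" for q
      proof -
        have "{x \<in> space M. f x < of_rat q} \<in> range G" unfolding range_G by (simp add: \<G>_def)
        then obtain i where i: "G i = {x \<in> space M. f x < of_rat q}" by (metis rangeE)
        have "{x \<in> X. f x < of_rat q} = G i \<inter> X" using X_sub unfolding i by blast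
        then show ?thesis using G_S by simp
      qed
      have "{x \<in> space S. f x < a} = (\<Union>q\<in>{q. of_rat q < a}. {x \<in> X. f x < of_rat q})"
        unfolding S(1) by (auto dest: of_rat_dense intro: less_trans)
      also have "\<dots> \<in> sets S" using rat by (intro sets.countable_UN') auto
      finally show ?thesis .
    qed
    then have f_S: "f \<in> borel_measurable S" by (simp add: borel_measurable_iff_less)
    have "f -` E \<inter> X \<in> sigma_sets (space ?M) ?\<V>" "f -` F \<inter> X \<in> sigma_sets (space ?M) ?\<V>"
      using measurable_sets[OF f_S EF(1)] measurable_sets[OF f_S EF(2)] unfolding S space_X .
    moreover have "X \<subseteq> space M - N" using X_good X_sub by blast
    then have "f -` E \<inter> X \<subseteq> A" "A \<subseteq> f -` F \<inter> X" using EF(3,4) A(2) by blast+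
    moreover have "f -` F \<inter> X - f -` E \<inter> X \<in> null_sets ?M"
    proof -
      have eq: "f -` F \<inter> X - f -` E \<inter> X = (f -` (F - E) \<inter> (space M - N)) \<inter> X"
        using \<open>X \<subseteq> space M - N\<close> by blast
      have "(f -` (F - E) \<inter> (space M - N)) \<inter> X \<in> null_sets M"
        using EF(5) X_sets by (rule null_set_Int2)
      then show ?thesis unfolding eq using X_sets by (subst null_sets_restrict_space) auto
    qed
    ultimately show "\<exists>E\<in>sigma_sets (space ?M) ?\<V>. \<exists>F\<in>sigma_sets (space ?M) ?\<V>.
        E \<subseteq> A \<and> A \<subseteq> F \<and> F - E \<in> null_sets ?M"
      by blast
  qed
  then interpret S: separating_family ?M V .
  show ?thesis
  proof (rule that[OF X_sets X_null X_inv S.good_metric_separation_dist]; intro allI ballI)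
    fix k x y assume xy: "x \<in> U (Suc k)" "y \<in> U (Suc k)"
    have "V m \<inter> U (Suc k) = {}" if "m < Suc k" for m
    proof -
      obtain i j where m: "m = prod_encode (i, j)" by (metis prod.exhaust prod_decode_inverse)
      then have "j \<le> m" by (simp add: le_prod_encode_2)
      with that have "U (Suc k) \<subseteq> U j" by (intro decseqD[OF U(2)]) simp
      then show ?thesis unfolding m V_encode by blast
    qed
    then show "separation_dist V x y < inverse (real (Suc k))"
      unfolding separation_dist_less_iff agree_def using xy by blast
  next
    fix k x assume "x \<in> X \<inter> B k"
    then have x: "x \<in> X" "x \<in> B k" by blast+
    have "B k \<in> range G" unfolding range_G by (simp add: \<G>_def)
    then obtain i where i: "G i = B k" by (metis rangeE)
    \<comment> \<open>With this \<open>j\<close> the point lies in \<open>B k - U j\<close>, a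
      member of the family, and all sufficiently close points lie in the same member.\<close>
    obtain j where j: "x \<notin> U j" using off_U[OF x(1)] by blast
    let ?m = "prod_encode (i, j)"
    have "y \<in> B k" if "separation_dist V x y < inverse (real (Suc ?m))" for y
    proof -
      have "x \<in> V ?m \<longleftrightarrow> y \<in> V ?m"
        using that unfolding separation_dist_less_iff agree_def by blast
      then show ?thesis using x(2) j by (simp add: V_encode i)
    qed
    then show "\<exists>e>0. \<forall>y\<in>X. separation_dist V x y < e \<longrightarrow> y \<in> B k"
      by (intro exI[of _ "inverse (real (Suc ?m))"]) auto
  qed
qed

text \<open>Failure of the bound gives sets \<open>C k\<close> of summable measure. In the metric
  built from their tails \<open>U k\<close>, a small ball around a point of \<open>B (Suc k)\<close>
  is sent at infinitely many times into \<open>U (Suc k)\<close>, whose points are less than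
  \<delta> apart once \<open>k\<close> is large.\<close>

theorem measurably_sensitive_imp_lower_bound:
  assumes M: "lebesgue_space M" "non_atomic M" and sens: "measurably_sensitive M T"
  shows "\<exists>\<epsilon>>0. \<forall>B\<in>sets M. \<forall>C\<in>sets M. 0 < measure M B \<longrightarrow>
      (\<exists>\<^sub>\<infinity>n. B - pre n C \<in> null_sets M) \<longrightarrow> \<epsilon> \<le> measure M C"
proof (rule ccontr)
  assume "\<not> ?thesis"
  then have neg: "\<exists>B\<in>sets M. \<exists>C\<in>sets M. 0 < measure M B \<and>
      (\<exists>\<^sub>\<infinity>n. B - pre n C \<in> null_sets M) \<and> measure M C < \<epsilon>" if "0 < \<epsilon>" for \<epsilon>
    using that by (fastforce simp: not_le)
  define Q where "Q k p \<longleftrightarrow> fst p \<in> sets M \<and> snd p \<in> sets M \<and> 0 < measure M (fst p) \<and>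
      (\<exists>\<^sub>\<infinity>n. fst p - pre n (snd p) \<in> null_sets M) \<and> measure M (snd p) < (1/2) ^ k"
    for k :: nat and p
  have "\<forall>k. \<exists>p. Q k p"
  proof
    fix k
    have "(0::real) < (1/2) ^ k" by simp
    from neg[OF this] obtain B C where "Q k (B, C)" unfolding Q_def fst_conv snd_conv by blast
    then show "\<exists>p. Q k p" ..
  qed
  then obtain p where p: "\<And>k. Q k (p k)" using choice[of Q] by blast
  define B0 C where "B0 k = fst (p k)" and "C k = snd (p k)" for k
  have B0 [measurable]: "B0 k \<in> sets M" and C [measurable]: "C k \<in> sets M"
    and pos: "0 < measure M (B0 k)"
    and inf: "\<exists>\<^sub>\<infinity>n. B0 k - pre n (C k) \<in> null_sets M"
    and C_small: "measure M (C k) < (1/2) ^ k" for k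
    using p[of k] unfolding Q_def B0_def C_def by blast+
  define K where "K k = {n. B0 k - pre n (C k) \<in> null_sets M}" for k
  \<comment> \<open>Discarding the exceptional null sets for all times in \<open>K k\<close> makes
    the inclusions exact, as distances are compared pointwise.\<close>
  define B where "B k = B0 k - (\<Union>n\<in>K k. B0 k - pre n (C k))" for k
  have B_null: "(\<Union>n\<in>K k. B0 k - pre n (C k)) \<in> null_sets M" for k
    by (intro null_sets_UN') (auto simp: K_def)
  have B [measurable]: "B k \<in> sets M" for k unfolding B_def using B0 null_setsD2[OF B_null] by (rule sets.Diff)
  have B_pos: "B k \<notin> null_sets M" for k
  proof
    assume "B k \<in> null_sets M"
    then have "B k \<union> (\<Union>n\<in>K k. B0 k - pre n (C k)) \<in> null_sets M" using B_null by blast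
    then have "B0 k \<in> null_sets M" by (rule null_sets_subset) (use B0 in \<open>auto simp: B_def\<close>)
    then show False using pos[of k] by (simp add: measure_eq_0_null_sets)
  qed
  have B_into: "(T ^^ n) x \<in> C k" if "x \<in> B k" "n \<in> K k" for x k n
    using that unfolding B_def pre_def by blast
  define U where "U k = (\<Union>i\<in>{k..}. C i)" for k
  have "summable (\<lambda>k. measure M (C k))"
    using C_small by (intro summable_comparison_test'[OF summable_geometric[of "1/2::real"]])
      (auto simp: less_imp_le)
  \<comment> \<open>By Borel-Cantelli the decreasing tails \<open>U k\<close> shrink to a null
    set.\<close>
  then have "limsup C \<in> null_sets M"
    by (intro borel_cantelli_limsup1) (auto simp: emeasure_eq_measure)
  then have U_null: "(\<Inter>k. U k) \<in> null_sets M" by (simp add: limsup_INF_SUP U_def)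
  have U_decseq: "decseq U" unfolding U_def decseq_def by force
  have U: "U k \<in> sets M" for k unfolding U_def by auto
  obtain f :: "'a \<Rightarrow> real" and N where f: "f \<in> borel_measurable M" "N \<in> null_sets M"
    "inj_on f (space M - N)"
    "\<forall>A\<in>sets M. \<exists>E\<in>sets borel. \<exists>F\<in>sets borel.
       f -` E \<inter> (space M - N) \<subseteq> A \<and> A \<inter> (space M - N) \<subseteq> f -` F \<and>
       f -` (F - E) \<inter> (space M - N) \<in> null_sets M"
    by (rule lebesgue_space_coding[OF M])
  obtain X d where X: "X \<in> sets M" "space M - X \<in> null_sets M" "T ` X \<subseteq> X"
    and d: "good_metric (restrict_space M X) d"
    and d_U: "\<forall>k. \<forall>x\<in>U (Suc k). \<forall>y\<in>U (Suc k). d x y < inverse (real (Suc k))"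
    and d_B: "\<forall>k. \<forall>x\<in>X \<inter> B k. \<exists>e>0. \<forall>y\<in>X. d x y < e \<longrightarrow> y \<in> B k"
    by (rule ex_good_metric[where B = B and U = U, OF f B U U_decseq U_null])
  let ?M = "restrict_space M X"
  have space_X: "space ?M = X" using sets.sets_into_space[OF X(1)] by (auto simp: space_restrict_space)
  have "T \<in> measurable ?M ?M"
    using X(3) measurable_funpow[of 1] by (intro measurable_restrict_space3) auto
  with sens d isomorphic_systems_restrict[OF X]
  have "\<exists>\<delta>>0. \<forall>x\<in>space ?M. \<forall>\<epsilon>>0. \<exists>N::nat. \<forall>n\<ge>N.
      0 < emeasure ?M {y \<in> Metric_space.mball (space ?M) d x \<epsilon>. \<delta> < d ((T ^^ n) x) ((T ^^ n) y)}"
    unfolding measurably_sensitive_def by blast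
  then obtain \<delta> where \<delta>: "0 < \<delta>" "\<And>x \<epsilon>. x \<in> X \<Longrightarrow> 0 < \<epsilon> \<Longrightarrow> \<exists>N::nat. \<forall>n\<ge>N.
      0 < emeasure ?M {y \<in> Metric_space.mball X d x \<epsilon>. \<delta> < d ((T ^^ n) x) ((T ^^ n) y)}"
    unfolding space_X by blast
  obtain k where k: "inverse (real (Suc k)) < \<delta>" using reals_Archimedean \<delta>(1) by blast
  have "\<not> B (Suc k) \<subseteq> space M - X"
    using B_pos[of "Suc k"] B[of "Suc k"] null_sets_subset[OF X(2)] by blast
  then obtain x where x: "x \<in> B (Suc k)" "x \<in> X"
    using sets.sets_into_space[OF B] by blast
  obtain e where e: "e > 0" "\<And>y. y \<in> X \<Longrightarrow> d x y < e \<Longrightarrow> y \<in> B (Suc k)"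
    using d_B x by blast
  obtain N where N: "\<And>n. n \<ge> N \<Longrightarrow>
      0 < emeasure ?M {y \<in> Metric_space.mball X d x e. \<delta> < d ((T ^^ n) x) ((T ^^ n) y)}"
    using \<delta>(2)[OF x(2) e(1)] by blast
  obtain n where n: "n \<ge> N" "n \<in> K (Suc k)"
    using inf[of "Suc k"] unfolding INFM_nat_le K_def by blast
  have "Metric_space X d" using d by (simp add: good_metric_def space_X)
  then have ball: "Metric_space.mball X d x e = {y \<in> X. d x y < e}"
    using x(2) by (auto simp: Metric_space.mball_def)
  have "{y \<in> Metric_space.mball X d x e. \<delta> < d ((T ^^ n) x) ((T ^^ n) y)} = {}"
  proof -
    have "d ((T ^^ n) x) ((T ^^ n) y) < \<delta>" if y: "y \<in> X" "d x y < e" for y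
    proof -
      have "(T ^^ n) x \<in> U (Suc k)" "(T ^^ n) y \<in> U (Suc k)"
        using B_into[OF _ n(2)] x(1) e(2)[OF y] unfolding U_def by auto
      then show ?thesis using d_U k less_trans by blast
    qed
    then show ?thesis unfolding ball by fastforce
  qed
  with N[OF n(1)] show False by simp
qed

end

theorem theorem4p6:
  fixes M :: "'a measure" and T :: "'a \<Rightarrow> 'a"
  assumes "prob_space M"
    and "lebesgue_space M"
    and "non_atomic M"
    and "measure_preserving M T"
    and "ergodic M T"
    and "measurably_sensitive M T"
  shows "\<exists>n>0. \<exists>A :: nat \<Rightarrow> 'a set.
           (\<forall>i<n. invariant_set M (T ^^ n) (A i) \<and> 0 < emeasure M (A i)) \<and>
           (\<forall>i<n. \<forall>j<n. i \<noteq> j \<longrightarrow> A i \<inter> A j \<in> null_sets M) \<and>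
           space M - (\<Union>i<n. A i) \<in> null_sets M \<and>
           (\<forall>i<n. lightly_mixing (restrict_space M (A i)) (T ^^ n))"
proof -
  interpret prob_space M by fact
  interpret finite_mpt M T by standard fact
  obtain \<epsilon> where \<epsilon>: "0 < \<epsilon>"
    "\<And>B C. B \<in> sets M \<Longrightarrow> C \<in> sets M \<Longrightarrow> 0 < measure M B \<Longrightarrow>
      \<exists>\<^sub>\<infinity>n. B - pre n C \<in> null_sets M \<Longrightarrow> \<epsilon> \<le> measure M C"
    using measurably_sensitive_imp_lower_bound[OF assms(2,3,6)] by blast
  show ?thesis
    by (rule lightly_mixing_decomposition[OF assms(5) _ \<epsilon>(1)])
      (simp add: prob_space, rule \<epsilon>(2), assumption+)
qed

end
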